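(* \textsc{Dilation $t$-Augmentation} can be solved in time $2^{\mathcal{O}(k\log k)}\cdot \Delta^{\mathcal{O}(kt)}\cdot n^{\mathcal{O}(1)}$, where $\Delta$ denotes the maximum degree of the graph $\Gamma$ and $n$ the number of vertices ($G$ is arbitrary).
   Context: Let $\Gamma$ be a finite undirected unweighted graph with vertex set $V$, and let $d_\Gamma(u,v)$ denote the shortest-path (hop) distance in $\Gamma$. A graph $G$ on the same vertex set $V$ is viewed as edge-weighted: each edge $(u,v)$ of $G$ has weight $d_\Gamma(u,v)$, and $d_G(u,v)$ denotes the weighted shortest-path distance in $G$. For a set $S$ of non-edges of $G$, $G+S=(V,E(G)\cup S)$ with the same weighting rule. $G+S$ has dilation at most $t$ if $d_{G+S}(u,v)\le t\cdot d_\Gamma(u,v)$ for all $u,v\in V$. \textsc{Dilation $t$-Augmentation}: given $(G,\Gamma,k)$, decide whether there is a set $S$ of at most $k$ non-edges of $G$ such that $G+S$ has dilation at most $t$. *)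

theory Defs
  imports Complex_Main "HOL-Library.Extended_Nat" "HOL-Library.Extended_Real"
begin

section \<open>Graphs and distances\<close>

text \<open>
  A finite simple undirected graph is a vertex set together with a set of two-element
  subsets of it.
\<close>

definition vertex_pairs :: "'a set \<Rightarrow> 'a set set" where
  "vertex_pairs V = {{u, v} | u v. u \<in> V \<and> v \<in> V \<and> u \<noteq> v}"

definition graph :: "'a set \<Rightarrow> 'a set set \<Rightarrow> bool" where
  "graph V E \<longleftrightarrow> finite V \<and> E \<subseteq> vertex_pairs V"

definition max_degree :: "'a set \<Rightarrow> 'a set set \<Rightarrow> nat" where
  "max_degree V E = Max ((\<lambda>v. card {u. {u, v} \<in> E}) ` V)"

definition walk :: "'a set set \<Rightarrow> 'a \<Rightarrow> 'a list \<Rightarrow> 'a \<Rightarrow> bool" where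
  "walk E u p v \<longleftrightarrow>
     p \<noteq> [] \<and> hd p = u \<and> last p = v \<and> successively (\<lambda>x y. {x, y} \<in> E) p"

definition walk_weight :: "('a \<Rightarrow> 'a \<Rightarrow> enat) \<Rightarrow> 'a list \<Rightarrow> enat" where
  "walk_weight w p = (\<Sum>i < length p - 1. w (p ! i) (p ! Suc i))"

text \<open>The distance is \<open>\<infinity>\<close> if there is no walk, since the infimum of the empty set is \<open>\<infinity>\<close>.\<close>

definition weighted_dist :: "('a \<Rightarrow> 'a \<Rightarrow> enat) \<Rightarrow> 'a set set \<Rightarrow> 'a \<Rightarrow> 'a \<Rightarrow> enat" where
  "weighted_dist w E u v = (INF p \<in> {p. walk E u p v}. walk_weight w p)"

definition hop_dist :: "'a set set \<Rightarrow> 'a \<Rightarrow> 'a \<Rightarrow> enat" where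
  "hop_dist E = weighted_dist (\<lambda>_ _. 1) E"

section \<open>The augmentation problem\<close>

text \<open>
  The graph \<open>\<Gamma>\<close> need not be connected. Pairs at infinite \<open>\<Gamma>\<close>-distance impose no
  constraint, because \<open>t * \<infinity> = \<infinity>\<close> for \<open>t > 0\<close>.
\<close>

definition dilation_at_most :: "real \<Rightarrow> 'a set \<Rightarrow> 'a set set \<Rightarrow> 'a set set \<Rightarrow> bool" where
  "dilation_at_most t V E\<^sub>\<Gamma> E \<longleftrightarrow>
     (\<forall>u\<in>V. \<forall>v\<in>V. ereal_of_enat (weighted_dist (hop_dist E\<^sub>\<Gamma>) E u v)
        \<le> ereal t * ereal_of_enat (hop_dist E\<^sub>\<Gamma> u v))"

definition dilation_augmentation ::
    "real \<Rightarrow> 'a set \<Rightarrow> 'a set set \<Rightarrow> 'a set set \<Rightarrow> nat \<Rightarrow> bool" where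
  "dilation_augmentation t V E\<^sub>G E\<^sub>\<Gamma> k \<longleftrightarrow>
     (\<exists>S. S \<subseteq> vertex_pairs V - E\<^sub>G \<and> card S \<le> k \<and> dilation_at_most t V E\<^sub>\<Gamma> (E\<^sub>G \<union> S))"

section \<open>Machine model\<close>

text \<open>
  Programs are structured programs for a random access machine over the natural numbers, with
  registers and an indirectly addressed memory. A program mentions only finitely many
  registers. Every instruction and every test costs one time unit. The arithmetic operations
  are addition and truncated subtraction only: with unit-cost multiplication the model would
  no longer be polynomially equivalent to Turing machines.
\<close>

datatype program =
    LoadConst nat nat
  | Add nat nat nat
  | Sub nat nat nat
  | Load nat nat
  | Store nat nat
  | Seq program program
  | IfNZ nat program program
  | WhileNZ nat program

type_synonym state = "(nat \<Rightarrow> nat) \<times> (nat \<Rightarrow> nat)"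

text \<open>
  \<open>exec P s \<tau> s'\<close>: started in \<open>s\<close>, program \<open>P\<close> halts after exactly \<open>\<tau>\<close> steps in \<open>s'\<close>. A state
  consists of the register contents and the memory contents.
\<close>

inductive exec :: "program \<Rightarrow> state \<Rightarrow> nat \<Rightarrow> state \<Rightarrow> bool" where
  LoadConst: "exec (LoadConst x a) (r, m) 1 (r(x := a), m)"
| Add: "exec (Add x y z) (r, m) 1 (r(x := r y + r z), m)"
| Sub: "exec (Sub x y z) (r, m) 1 (r(x := r y - r z), m)"
| Load: "exec (Load x y) (r, m) 1 (r(x := m (r y)), m)"
| Store: "exec (Store x y) (r, m) 1 (r, m(r x := r y))"
| Seq: "exec P s \<tau> s' \<Longrightarrow> exec Q s' \<tau>' s'' \<Longrightarrow> exec (Seq P Q) s (\<tau> + \<tau>') s''"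
| IfTrue: "fst s x \<noteq> 0 \<Longrightarrow> exec P s \<tau> s' \<Longrightarrow> exec (IfNZ x P Q) s (Suc \<tau>) s'"
| IfFalse: "fst s x = 0 \<Longrightarrow> exec Q s \<tau> s' \<Longrightarrow> exec (IfNZ x P Q) s (Suc \<tau>) s'"
| WhileFalse: "fst s x = 0 \<Longrightarrow> exec (WhileNZ x P) s 1 s"
| WhileTrue: "fst s x \<noteq> 0 \<Longrightarrow> exec P s \<tau> s' \<Longrightarrow> exec (WhileNZ x P) s' \<tau>' s'' \<Longrightarrow>
    exec (WhileNZ x P) s (Suc (\<tau> + \<tau>')) s''"

inductive_cases exec_LoadConstE: "exec (LoadConst x a) s \<tau> s'"
inductive_cases exec_AddE: "exec (Add x y z) s \<tau> s'"
inductive_cases exec_SubE: "exec (Sub x y z) s \<tau> s'"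
inductive_cases exec_LoadE: "exec (Load x y) s \<tau> s'"
inductive_cases exec_StoreE: "exec (Store x y) s \<tau> s'"
inductive_cases exec_SeqE: "exec (Seq P Q) s \<tau> s'"
inductive_cases exec_IfE: "exec (IfNZ x P Q) s \<tau> s'"
inductive_cases exec_WhileE: "exec (WhileNZ x P) s \<tau> s'"

lemma exec_deterministic:
  assumes "exec P s \<tau> s'" and "exec P s \<tau>' s''"
  shows "\<tau>' = \<tau> \<and> s'' = s'"
  using assms
proof (induction arbitrary: \<tau>' s'' rule: exec.induct)
  case (Seq P s \<tau>1 s1 Q \<tau>2 s2)
  from Seq.prems show ?case by (rule exec_SeqE) (use Seq.IH in metis)
next
  case (IfTrue s x P \<tau> s' Q)
  from IfTrue.prems show ?case
  proof (rule exec_IfE)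
    fix \<tau>1
    assume "\<tau>' = Suc \<tau>1" "exec P s \<tau>1 s''"
    then show ?thesis using IfTrue.IH by blast
  qed (use IfTrue.hyps in auto)
next
  case (IfFalse s x Q \<tau> s' P)
  from IfFalse.prems show ?case
  proof (rule exec_IfE)
    fix \<tau>1
    assume "\<tau>' = Suc \<tau>1" "exec Q s \<tau>1 s''"
    then show ?thesis using IfFalse.IH by blast
  qed (use IfFalse.hyps in auto)
next
  case (WhileFalse s x P)
  from WhileFalse.prems show ?case by (rule exec_WhileE) (use WhileFalse.hyps in auto)
next
  case (WhileTrue s x P \<tau>1 s1 \<tau>2 s2)
  from WhileTrue.prems show ?case
  proof (rule exec_WhileE)
    fix \<tau>3 s3 \<tau>4
    assume *: "\<tau>' = Suc (\<tau>3 + \<tau>4)" "exec P s \<tau>3 s3" "exec (WhileNZ x P) s3 \<tau>4 s''"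
    from WhileTrue.IH(1)[OF *(2)] WhileTrue.IH(2) *(1,3) show ?thesis by auto
  qed (use WhileTrue.hyps in auto)
qed (auto elim: exec_LoadConstE exec_AddE exec_SubE exec_LoadE exec_StoreE)

text \<open>
  Instances have vertex set \<open>{..<n}\<close>. Initially register 0 holds \<open>n\<close>, register 1 holds \<open>k\<close>, and
  the memory holds the adjacency matrix of \<open>G\<close> followed by that of \<open>\<Gamma>\<close>, both in row-major order;
  everything else is zero. The answer is read off register 0.
\<close>

definition adjacency_entry :: "nat \<Rightarrow> nat set set \<Rightarrow> nat \<Rightarrow> nat" where
  "adjacency_entry n E a = (if {a div n, a mod n} \<in> E then 1 else 0)"

definition input_state :: "nat \<Rightarrow> nat set set \<Rightarrow> nat set set \<Rightarrow> nat \<Rightarrow> state" where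
  "input_state n E\<^sub>G E\<^sub>\<Gamma> k =
     ((\<lambda>_. 0)(0 := n, 1 := k),
      \<lambda>a. if a < n * n then adjacency_entry n E\<^sub>G a
          else if a < 2 * (n * n) then adjacency_entry n E\<^sub>\<Gamma> (a - n * n)
          else 0)"

definition answers_within :: "program \<Rightarrow> state \<Rightarrow> bool \<Rightarrow> real \<Rightarrow> bool" where
  "answers_within P s b T \<longleftrightarrow>
     (\<exists>\<tau> s'. exec P s \<tau> s' \<and> fst s' 0 = (if b then 1 else 0) \<and> real \<tau> \<le> T)"

text \<open>
  The factors \<open>2 powr O(k log k)\<close>, \<open>\<Delta> powr O(k t)\<close> and \<open>n ^ O(1)\<close> with their hidden constants made
  explicit. For an edgeless \<open>\<Gamma>\<close> the second factor is read as 1 rather than 0, and \<open>k log k\<close> is 0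
  for \<open>k = 0\<close>.
\<close>

definition time_bound ::
    "real \<Rightarrow> real \<Rightarrow> real \<Rightarrow> nat \<Rightarrow> real \<Rightarrow> nat \<Rightarrow> nat \<Rightarrow> nat \<Rightarrow> real" where
  "time_bound c\<^sub>0 c\<^sub>1 c\<^sub>2 c\<^sub>3 t k \<Delta> n =
     c\<^sub>0 * 2 powr (c\<^sub>1 * (real k * log 2 (real k)))
        * real (max 1 \<Delta>) powr (c\<^sub>2 * (real k * t)) * real n ^ c\<^sub>3"

end

theory Submission
  imports Defs
begin

text \<open>
  If some edge \<open>uv\<close> of \<open>\<Gamma>\<close> violates the dilation bound, then every solution contains an edge both of
  whose endpoints lie in the ball of radius \<open>T = \<lfloor>t\<rfloor>\<close> around \<open>u\<close> in \<open>\<Gamma>\<close>, because a path of weight at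
  most \<open>T\<close> cannot leave that ball. Up to constant factors the ball has at most \<open>\<Delta>\<^bsup>2T\<^esup>\<close> vertices,
  so branching over its pairs of vertices yields a search tree of depth \<open>k\<close> and branching degree
  \<open>4 \<Delta>\<^bsup>4T\<^esup>\<close>. The tree is searched breadth-first, each node costing polynomial time. The factor
  \<open>2\<^bsup>O(k log k)\<^esup>\<close> only absorbs \<open>(k + 1) 4\<^sup>k\<close>.
\<close>

section \<open>Distances and branching\<close>

text \<open>The constants of the time bound must not depend on \<open>t\<close>, while the program
  may. So \<open>T\<close> enters the code as a literal of unit cost, and a node is processed in a
  language whose only loops run \<open>n\<close> times: its cost is a polynomial in \<open>n\<close>
  by the mere shape of the code. The one \<open>WhileNZ\<close> written by hand, in
  \<open>solver\<close>, takes at most one round per node of the search tree. A queue in memory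
  stands in for recursion, which the machine does not offer. Truncating all distances at
  \<open>T + 1\<close> removes infinity from the computation and preserves every comparison with
  \<open>T\<close>. Inequalities between distances in different graphs come from potentials,
  functions that grow along an edge by at most its weight. The ball estimate has one critical case.
  The crude growth rate \<open>\<Delta> + 1\<close> can be replaced by \<open>\<Delta> ^ 2\<close>
  only if \<open>\<Delta> \<ge> 2\<close>; for \<open>\<Delta> = 1\<close> it would leave a factor
  \<open>2 ^ T\<close> per ball, which neither \<open>\<Delta> powr O(k t)\<close> nor
  \<open>2 powr O(k log k)\<close> absorbs. In that case \<Gamma> is a matching, and balls of any
  radius have at most two vertices.\<close>

lemma walk_weight_snoc:
  assumes "p \<noteq> []"
  shows "walk_weight w (p @ [y]) = walk_weight w p + w (last p) y"
proof -
  obtain m where m: "length p = Suc m" using assms by (cases p) auto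
  have "walk_weight w (p @ [y]) = (\<Sum>i<Suc m. w ((p @ [y]) ! i) ((p @ [y]) ! Suc i))"
    by (simp add: walk_weight_def m)
  also have "\<dots> = (\<Sum>i<m. w (p ! i) (p ! Suc i)) + w (p ! m) y"
    using m by (simp add: nth_append)
  finally show ?thesis using m assms by (simp add: walk_weight_def last_conv_nth)
qed

lemma weighted_dist_le: "walk E u p v \<Longrightarrow> weighted_dist w E u v \<le> walk_weight w p"
  unfolding weighted_dist_def by (intro INF_lower) simp

text \<open>Every nonempty set of extended naturals has a least element, so a finite infimum is the
  weight of an actual walk, although there may be infinitely many walks.\<close>

lemma weighted_dist_attained:
  assumes "weighted_dist w E u v \<noteq> \<infinity>"
  obtains p where "walk E u p v" "walk_weight w p = weighted_dist w E u v"
proof -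
  let ?W = "walk_weight w ` {p. walk E u p v}"
  have "?W \<noteq> {}" using assms unfolding weighted_dist_def
    by (metis Inf_empty top_enat_def)
  then have "Inf ?W \<in> ?W" unfolding Inf_enat_def by (auto intro: LeastI)
  then show ?thesis using that unfolding weighted_dist_def by auto
qed

lemma weighted_dist_refl [simp]: "weighted_dist w E u u = 0"
  using weighted_dist_le[of E u "[u]" u w] by (simp add: walk_def walk_weight_def)

lemma weighted_dist_step:
  assumes "{x, v} \<in> E"
  shows "weighted_dist w E u v \<le> weighted_dist w E u x + w x v"
proof (cases "weighted_dist w E u x = \<infinity>")
  case False
  then obtain p where p: "walk E u p x" "walk_weight w p = weighted_dist w E u x"
    by (rule weighted_dist_attained)
  then have "walk E u (p @ [v]) v" "p \<noteq> []" "last p = x"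
    using assms by (auto simp: walk_def successively_append_iff)
  then show ?thesis using weighted_dist_le[of E u "p @ [v]" v w] p(2) walk_weight_snoc[of p w v] by simp
qed simp

lemma weighted_dist_edge: "{u, v} \<in> E \<Longrightarrow> weighted_dist w E u v \<le> w u v"
  using weighted_dist_step[of u v E w u] by simp

text \<open>The increments permitted by the single edges add up along the walk.\<close>

lemma potential_le_walk:
  fixes f :: "'a \<Rightarrow> enat"
  assumes "\<And>x y. {x, y} \<in> E \<Longrightarrow> f y \<le> f x + w x y" and "walk E u p v"
  shows "f v \<le> f u + walk_weight w p"
proof -
  have "p \<noteq> []" using assms(2) by (simp add: walk_def)
  then show ?thesis using assms(2)
  proof (induction p arbitrary: v rule: rev_nonempty_induct)
    case (single x)
    then have "u = v" by (auto simp: walk_def)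
    then show ?case by simp
  next
    case (snoc x p)
    then have "walk E u p (last p)" "{last p, v} \<in> E" "x = v"
      by (auto simp: walk_def successively_append_iff)
    then have "f v \<le> f u + walk_weight w p + w (last p) v"
      using snoc.IH[of "last p"] assms(1)[of "last p" v] by (meson add_right_mono order_trans)
    then show ?case using snoc.hyps \<open>x = v\<close> by (simp add: walk_weight_snoc add.assoc)
  qed
qed

text \<open>Shortest-path duality: comparing potentials replaces cutting and splicing walks.\<close>

lemma potential_le_weighted_dist:
  fixes f :: "'a \<Rightarrow> enat"
  assumes "\<And>x y. {x, y} \<in> E \<Longrightarrow> f y \<le> f x + w x y"
  shows "f v \<le> f u + weighted_dist w E u v"
proof (cases "weighted_dist w E u v = \<infinity>")
  case False
  then obtain p where "walk E u p v" "walk_weight w p = weighted_dist w E u v"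
    by (rule weighted_dist_attained)
  then show ?thesis using potential_le_walk[of E f w, OF assms] by metis
qed simp

lemma weighted_dist_triangle:
  "weighted_dist w E u v \<le> weighted_dist w E u x + weighted_dist w E x v"
  by (rule potential_le_weighted_dist) (rule weighted_dist_step)

lemma hop_dist_refl [simp]: "hop_dist E u u = 0"
  by (simp add: hop_dist_def)

lemma hop_dist_triangle: "hop_dist E u v \<le> hop_dist E u x + hop_dist E x v"
  unfolding hop_dist_def by (rule weighted_dist_triangle)

text \<open>By the triangle inequality the hop distance from \<open>u\<close> is a potential for its
  own weights on any edge set \<open>F\<close>, also across pairs that are not edges of \<Gamma>.
  Shortcuts thus never beat the distance in \<Gamma>.\<close>

lemma hop_dist_le_weighted_dist: "hop_dist E u v \<le> weighted_dist (hop_dist E) F u v"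
  using potential_le_weighted_dist[of F "hop_dist E u" "hop_dist E" v u] hop_dist_triangle by force

text \<open>A walk weighs \<open>c\<close> times its number of edges. Finiteness of the hop distance
  excludes \<open>0 * \<infinity> = 0\<close>, which would be a false bound at
  \<open>c = 0\<close>.\<close>

lemma weighted_dist_const:
  assumes "hop_dist E u v \<noteq> \<infinity>"
  shows "weighted_dist (\<lambda>_ _. c) E u v \<le> c * hop_dist E u v"
proof -
  obtain p where "walk E u p v" "walk_weight (\<lambda>_ _. 1) p = hop_dist E u v"
    using assms unfolding hop_dist_def by (rule weighted_dist_attained)
  then show ?thesis using weighted_dist_le[of E u p v "\<lambda>_ _. c"]
    by (simp add: walk_weight_def mult.commute)
qed

section \<open>Reduction of dilation to the edges of \<Gamma>\<close>

definition spans :: "nat \<Rightarrow> 'a set set \<Rightarrow> 'a set set \<Rightarrow> bool" where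
  "spans T E\<^sub>\<Gamma> E \<longleftrightarrow> (\<forall>u v. {u, v} \<in> E\<^sub>\<Gamma> \<longrightarrow> weighted_dist (hop_dist E\<^sub>\<Gamma>) E u v \<le> enat T)"

text \<open>A dilation bound need only be checked on the edges of \<open>\<Gamma>\<close>, where all relevant distances are
  integers. Hence only \<open>\<lfloor>t\<rfloor>\<close> matters, and a program for an arbitrary real \<open>t\<close> exists.\<close>

lemma dilation_at_most_iff_spans:
  assumes "0 < t" and "graph V E\<^sub>\<Gamma>"
  shows "dilation_at_most t V E\<^sub>\<Gamma> E \<longleftrightarrow> spans (nat \<lfloor>t\<rfloor>) E\<^sub>\<Gamma> E"
proof
  assume dil: "dilation_at_most t V E\<^sub>\<Gamma> E"
  show "spans (nat \<lfloor>t\<rfloor>) E\<^sub>\<Gamma> E"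
    unfolding spans_def
  proof (intro allI impI)
    fix u v assume uv: "{u, v} \<in> E\<^sub>\<Gamma>"
    then have "u \<in> V" "v \<in> V" using assms(2) by (auto simp: graph_def vertex_pairs_def doubleton_eq_iff)
    then have "ereal_of_enat (weighted_dist (hop_dist E\<^sub>\<Gamma>) E u v)
        \<le> ereal t * ereal_of_enat (hop_dist E\<^sub>\<Gamma> u v)"
      using dil by (simp add: dilation_at_most_def)
    also have "hop_dist E\<^sub>\<Gamma> u v \<le> 1"
      using weighted_dist_edge[OF uv, of "\<lambda>_ _. 1"] by (simp add: hop_dist_def)
    then have "ereal t * ereal_of_enat (hop_dist E\<^sub>\<Gamma> u v) \<le> ereal t * ereal_of_enat 1"
      using assms(1) by (intro ereal_mult_left_mono) (auto simp flip: ereal_of_enat_le_iff)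
    finally have le: "ereal_of_enat (weighted_dist (hop_dist E\<^sub>\<Gamma>) E u v) \<le> ereal t"
      by (simp add: one_enat_def)
    then show "weighted_dist (hop_dist E\<^sub>\<Gamma>) E u v \<le> enat (nat \<lfloor>t\<rfloor>)"
      by (cases "weighted_dist (hop_dist E\<^sub>\<Gamma>) E u v") (auto simp: le_nat_floor)
  qed
next
  assume sp: "spans (nat \<lfloor>t\<rfloor>) E\<^sub>\<Gamma> E"
  show "dilation_at_most t V E\<^sub>\<Gamma> E"
    unfolding dilation_at_most_def
  proof (intro ballI)
    fix u v
    let ?d = "hop_dist E\<^sub>\<Gamma> u v" and ?w = "weighted_dist (hop_dist E\<^sub>\<Gamma>) E"
    show "ereal_of_enat (?w u v) \<le> ereal t * ereal_of_enat ?d"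
    proof (cases ?d)
      case (enat a)
      \<comment> \<open>This makes \<open>?w u\<close> a potential on \<Gamma> for the constant
        weight \<open>\<lfloor>t\<rfloor>\<close>: replacing each edge of a shortest path of
        \<Gamma> by a detour costs at most \<open>\<lfloor>t\<rfloor>\<close> per edge.\<close>
      have "?w u y \<le> ?w u x + enat (nat \<lfloor>t\<rfloor>)" if "{x, y} \<in> E\<^sub>\<Gamma>" for x y
        using sp that weighted_dist_triangle[of "hop_dist E\<^sub>\<Gamma>" E u y x]
        by (meson add_left_mono order_trans spans_def)
      from potential_le_weighted_dist[of E\<^sub>\<Gamma> "?w u" "\<lambda>_ _. enat (nat \<lfloor>t\<rfloor>)" v u, OF this]
      have "?w u v \<le> weighted_dist (\<lambda>_ _. enat (nat \<lfloor>t\<rfloor>)) E\<^sub>\<Gamma> u v" by simp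
      also have "\<dots> \<le> enat (nat \<lfloor>t\<rfloor>) * ?d" by (rule weighted_dist_const) (simp add: enat)
      finally have "?w u v \<le> enat (nat \<lfloor>t\<rfloor> * a)" by (simp add: enat)
      then obtain b where b: "?w u v = enat b" "b \<le> nat \<lfloor>t\<rfloor> * a" by (cases "?w u v") auto
      have "real b \<le> real (nat \<lfloor>t\<rfloor>) * real a" using b(2) by (metis of_nat_le_iff of_nat_mult)
      also have "\<dots> \<le> t * real a" using assms(1) by (intro mult_right_mono) auto
      finally show ?thesis by (simp add: b(1) enat)
    qed (use assms(1) in simp)
  qed
qed

section \<open>The branching rule\<close>

text \<open>Unlike in \<open>dilation_augmentation\<close>, \<open>S\<close> may meet
  \<open>E\<close>. Branching may then insert a pair without checking whether it is already an edge;
  removing the overlap from \<open>S\<close> only lowers its cardinality.\<close>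

definition augmentable :: "nat \<Rightarrow> 'a set \<Rightarrow> 'a set set \<Rightarrow> nat \<Rightarrow> 'a set set \<Rightarrow> bool" where
  "augmentable T V E\<^sub>\<Gamma> k E \<longleftrightarrow> (\<exists>S\<subseteq>vertex_pairs V. card S \<le> k \<and> spans T E\<^sub>\<Gamma> (E \<union> S))"

lemma finite_vertex_pairs: "finite V \<Longrightarrow> finite (vertex_pairs V)"
  by (rule finite_subset[of _ "Pow V"]) (auto simp: vertex_pairs_def)

lemma dilation_augmentation_iff_augmentable:
  assumes "0 < t" "graph V E\<^sub>\<Gamma>"
  shows "dilation_augmentation t V E\<^sub>G E\<^sub>\<Gamma> k \<longleftrightarrow> augmentable (nat \<lfloor>t\<rfloor>) V E\<^sub>\<Gamma> k E\<^sub>G"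
proof
  assume "augmentable (nat \<lfloor>t\<rfloor>) V E\<^sub>\<Gamma> k E\<^sub>G"
  then obtain S where S: "S \<subseteq> vertex_pairs V" "card S \<le> k" "spans (nat \<lfloor>t\<rfloor>) E\<^sub>\<Gamma> (E\<^sub>G \<union> S)"
    by (auto simp: augmentable_def)
  have "finite S" using S(1) assms(2) finite_vertex_pairs finite_subset by (auto simp: graph_def)
  then have "card (S - E\<^sub>G) \<le> card S" by (intro card_mono) auto
  then show "dilation_augmentation t V E\<^sub>G E\<^sub>\<Gamma> k" using S
    by (auto simp: dilation_augmentation_def dilation_at_most_iff_spans[OF assms] intro!: exI[of _ "S - E\<^sub>G"])
qed (auto simp: dilation_augmentation_def augmentable_def dilation_at_most_iff_spans[OF assms])

lemma augmentable_spans: "spans T E\<^sub>\<Gamma> E \<Longrightarrow> augmentable T V E\<^sub>\<Gamma> k E"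
  unfolding augmentable_def by (intro exI[of _ "{}"]) simp

lemma augmentable_0:
  assumes "finite V" "augmentable T V E\<^sub>\<Gamma> 0 E"
  shows "spans T E\<^sub>\<Gamma> E"
proof -
  obtain S where S: "S \<subseteq> vertex_pairs V" "card S = 0" "spans T E\<^sub>\<Gamma> (E \<union> S)"
    using assms(2) by (auto simp: augmentable_def)
  then have "S = {}" using assms(1) finite_vertex_pairs finite_subset by (metis card_eq_0_iff)
  then show ?thesis using S(3) by simp
qed

text \<open>If no added edge lay inside the ball, then the distance from \<open>u\<close> before the addition, truncated
  at \<open>T + 1\<close>, would still satisfy the constraints of the larger graph.\<close>

lemma added_edge_in_ball:
  assumes "spans T E\<^sub>\<Gamma> (E \<union> S)" "{u, v} \<in> E\<^sub>\<Gamma>" and long: "\<not> weighted_dist (hop_dist E\<^sub>\<Gamma>) E u v \<le> enat T"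
  shows "\<exists>x y. {x, y} \<in> S \<and> hop_dist E\<^sub>\<Gamma> u x \<le> enat T \<and> hop_dist E\<^sub>\<Gamma> u y \<le> enat T"
proof (rule ccontr)
  assume none: "\<not> ?thesis"
  let ?d = "hop_dist E\<^sub>\<Gamma>"
  \<comment> \<open>The cap \<open>T + 1\<close> is large enough to record that \<open>v\<close> is
    too far from \<open>u\<close>, and small enough that leaving the ball already costs that
    much.\<close>
  let ?f = "\<lambda>z. min (weighted_dist ?d E u z) (enat (Suc T))"
  have "?f y \<le> ?f x + ?d x y" if xy: "{x, y} \<in> E \<union> S" for x y
  proof (cases "{x, y} \<in> E")
    case True
    have "?f y \<le> min (weighted_dist ?d E u x + ?d x y) (enat (Suc T) + ?d x y)"
      using weighted_dist_step[OF True, of ?d u] by (auto simp: min_le_iff_disj intro: order_trans)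
    also have "\<dots> \<le> ?f x + ?d x y" by (simp add: min_def)
    finally show ?thesis .
  next
    case False
    \<comment> \<open>A new edge has an endpoint outside the ball. If it is \<open>x\<close>, then
      \<open>?f x\<close> has already reached the cap; if it is \<open>y\<close>, then the weight of
      the edge lifts the right-hand side to the cap.\<close>
    then have "\<not> ?d u x \<le> enat T \<or> \<not> ?d u y \<le> enat T" using none xy by blast
    then have "enat (Suc T) \<le> ?f x + ?d x y"
    proof
      assume "\<not> ?d u x \<le> enat T"
      then have "enat (Suc T) \<le> weighted_dist ?d E u x"
        using hop_dist_le_weighted_dist[of E\<^sub>\<Gamma> u x E] Suc_ile_eq[of T] by (meson not_le order_trans)
      then show ?thesis by (simp add: min_def add_increasing2)
    next
      assume "\<not> ?d u y \<le> enat T"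
      then have "enat (Suc T) \<le> ?d u y" using Suc_ile_eq[of T] by (meson not_le)
      also have "\<dots> \<le> ?d u x + ?d x y" by (rule hop_dist_triangle)
      also have "\<dots> \<le> weighted_dist ?d E u x + ?d x y"
        by (intro add_right_mono hop_dist_le_weighted_dist)
      finally show ?thesis by (simp add: min_def add_increasing2)
    qed
    then show ?thesis by (meson min.cobounded2 order_trans)
  qed
  from potential_le_weighted_dist[of "E \<union> S" ?f ?d v u, OF this]
  have "?f v \<le> weighted_dist ?d (E \<union> S) u v" by simp
  also have "\<dots> \<le> enat T" using assms(1,2) by (simp add: spans_def)
  finally show False using long by (simp add: min_le_iff_disj)
qed

text \<open>By \<open>added_edge_in_ball\<close> every solution contains a candidate pair, which is
  moved from \<open>S\<close> into \<open>E\<close> at the price of one unit of budget. The order on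
  the vertices serves to list each unordered pair once.\<close>

lemma augmentable_Suc:
  fixes V :: "'a :: linorder set"
  assumes "finite V" and uv: "{u, v} \<in> E\<^sub>\<Gamma>" "\<not> weighted_dist (hop_dist E\<^sub>\<Gamma>) E u v \<le> enat T"
  shows "augmentable T V E\<^sub>\<Gamma> (Suc k) E \<longleftrightarrow>
    (\<exists>x\<in>V. \<exists>y\<in>V. x < y \<and> hop_dist E\<^sub>\<Gamma> u x \<le> enat T \<and> hop_dist E\<^sub>\<Gamma> u y \<le> enat T \<and>
      augmentable T V E\<^sub>\<Gamma> k (insert {x, y} E))"
proof
  assume "augmentable T V E\<^sub>\<Gamma> (Suc k) E"
  then obtain S where S: "S \<subseteq> vertex_pairs V" "card S \<le> Suc k" "spans T E\<^sub>\<Gamma> (E \<union> S)"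
    by (auto simp: augmentable_def)
  have fin: "finite S" using S(1) assms(1) finite_vertex_pairs finite_subset by blast
  obtain a b where ab: "{a, b} \<in> S" "hop_dist E\<^sub>\<Gamma> u a \<le> enat T" "hop_dist E\<^sub>\<Gamma> u b \<le> enat T"
    using added_edge_in_ball[OF S(3) uv] by blast
  have "a \<in> V" "b \<in> V" "a \<noteq> b" using ab(1) S(1) by (auto simp: vertex_pairs_def doubleton_eq_iff)
  then obtain x y where xy: "x \<in> V" "y \<in> V" "x < y" "{x, y} \<in> S"
      "hop_dist E\<^sub>\<Gamma> u x \<le> enat T" "hop_dist E\<^sub>\<Gamma> u y \<le> enat T"
  proof (cases "a < b")
    case True
    then show ?thesis using that[of a b] ab \<open>a \<in> V\<close> \<open>b \<in> V\<close> by blast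
  next
    case False
    then have "b < a" using \<open>a \<noteq> b\<close> by simp
    moreover have "{b, a} \<in> S" using ab(1) by (simp add: insert_commute)
    ultimately show ?thesis using that[of b a] ab \<open>a \<in> V\<close> \<open>b \<in> V\<close> by blast
  qed
  have "insert {x, y} E \<union> (S - {{x, y}}) = E \<union> S" using xy(4) by blast
  moreover have "card (S - {{x, y}}) \<le> k" using S(2) xy(4) fin by simp
  ultimately have "augmentable T V E\<^sub>\<Gamma> k (insert {x, y} E)"
    using S by (auto simp: augmentable_def intro!: exI[of _ "S - {{x, y}}"])
  then show "\<exists>x\<in>V. \<exists>y\<in>V. x < y \<and> hop_dist E\<^sub>\<Gamma> u x \<le> enat T \<and> hop_dist E\<^sub>\<Gamma> u y \<le> enat T \<and>
      augmentable T V E\<^sub>\<Gamma> k (insert {x, y} E)"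
    using xy by blast
next
  assume "\<exists>x\<in>V. \<exists>y\<in>V. x < y \<and> hop_dist E\<^sub>\<Gamma> u x \<le> enat T \<and> hop_dist E\<^sub>\<Gamma> u y \<le> enat T \<and>
      augmentable T V E\<^sub>\<Gamma> k (insert {x, y} E)"
  then obtain x y S where xy: "x \<in> V" "y \<in> V" "x < y" and
    S: "S \<subseteq> vertex_pairs V" "card S \<le> k" "spans T E\<^sub>\<Gamma> (insert {x, y} E \<union> S)"
    by (auto simp: augmentable_def)
  have "insert {x, y} S \<subseteq> vertex_pairs V" using S(1) xy by (auto simp: vertex_pairs_def)
  moreover have "card (insert {x, y} S) \<le> Suc k" using S(2) card_insert_le_m1 by (simp add: card_insert_if finite_subset[OF S(1)] finite_vertex_pairs assms(1))
  moreover have "spans T E\<^sub>\<Gamma> (E \<union> insert {x, y} S)" using S(3) by simp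
  ultimately show "augmentable T V E\<^sub>\<Gamma> (Suc k) E" unfolding augmentable_def by blast
qed

section \<open>Sizes of balls\<close>

lemma card_neighbours_le:
  assumes "graph V E"
  shows "finite {x. {x, v} \<in> E}" "card {x. {x, v} \<in> E} \<le> max_degree V E"
proof -
  have fin: "finite V" and sub: "E \<subseteq> vertex_pairs V" using assms by (auto simp: graph_def)
  have "{x. {x, v} \<in> E} \<subseteq> V" using sub by (auto simp: vertex_pairs_def doubleton_eq_iff)
  then show "finite {x. {x, v} \<in> E}" using fin finite_subset by blast
  show "card {x. {x, v} \<in> E} \<le> max_degree V E"
  proof (cases "v \<in> V")
    case True
    then show ?thesis unfolding max_degree_def using fin by (intro Max_ge) auto
  next
    case False
    then have "{x. {x, v} \<in> E} = {}" using sub by (auto simp: vertex_pairs_def doubleton_eq_iff)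
    then show ?thesis by (metis card.empty le0)
  qed
qed

text \<open>\<open>Z m\<close> collects what is reachable in \<open>m\<close> rounds of adding
  neighbours; a vertex contributes itself and at most \<open>D\<close> neighbours per round. The
  index of the round that discovers a vertex is a potential for unit weights, so it is at most the
  hop distance, and the ball lies in \<open>Z r\<close>.\<close>

lemma ball_growth:
  assumes "graph V E"
  defines "D \<equiv> max_degree V E"
  shows "finite {x. hop_dist E u x \<le> enat r} \<and> card {x. hop_dist E u x \<le> enat r} \<le> (D + 1) ^ r"
proof -
  define Z where "Z = rec_nat {u} (\<lambda>_ X. X \<union> (\<Union>x\<in>X. {y. {y, x} \<in> E}))"
  have Z: "Z 0 = {u}" "\<And>m. Z (Suc m) = (\<Union>x\<in>Z m. insert x {y. {y, x} \<in> E})"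
    by (auto simp: Z_def)
  have Zmono: "Z m \<subseteq> Z m'" if "m \<le> m'" for m m'
    using that by (induction rule: dec_induct) (auto simp: Z(2))
  have ZD: "finite (Z m) \<and> card (Z m) \<le> (D + 1) ^ m" for m
  proof (induction m)
    case (Suc m)
    have "card (insert x {y. {y, x} \<in> E}) \<le> D + 1" for x
      using card_neighbours_le[OF assms(1), of x] unfolding D_def
      by (simp add: card_insert_if le_SucI)
    then have "card (Z (Suc m)) \<le> (\<Sum>x\<in>Z m. D + 1)"
      unfolding Z(2) using Suc by (intro order_trans[OF card_UN_le] sum_mono) auto
    also have "\<dots> = card (Z m) * (D + 1)" by simp
    also have "\<dots> \<le> (D + 1) ^ m * (D + 1)" using Suc by (intro mult_right_mono) auto
    finally show ?case using Suc card_neighbours_le[OF assms(1)] by (auto simp: Z(2) mult.commute)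
  qed (simp add: Z)
  define f where "f = (\<lambda>x. if \<exists>m. x \<in> Z m then enat (LEAST m. x \<in> Z m) else \<infinity>)"
  have f_iff: "f x \<le> enat m \<longleftrightarrow> x \<in> Z m" for x m
  proof
    assume "f x \<le> enat m"
    then have "\<exists>m. x \<in> Z m" "(LEAST m. x \<in> Z m) \<le> m" by (auto simp: f_def split: if_splits)
    then show "x \<in> Z m" using Zmono LeastI_ex[of "\<lambda>m. x \<in> Z m"] by blast
  next
    assume "x \<in> Z m"
    then show "f x \<le> enat m" by (auto simp: f_def intro: Least_le)
  qed
  have "f y \<le> f x + 1" if "{x, y} \<in> E" for x y
  proof (cases "f x")
    case (enat m)
    then have "x \<in> Z m" using f_iff[of x m] by simp
    then have "y \<in> Z (Suc m)" using that by (auto simp: Z(2) insert_commute)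
    then show ?thesis using f_iff[of y "Suc m"] enat by (simp add: one_enat_def)
  qed simp
  then have "f x \<le> f u + hop_dist E u x" for x
    unfolding hop_dist_def by (rule potential_le_weighted_dist)
  moreover have "f u = 0" using f_iff[of u 0] by (simp add: Z(1) zero_enat_def[symmetric])
  ultimately have "{x. hop_dist E u x \<le> enat r} \<subseteq> Z r" using f_iff order_trans by fastforce
  then show ?thesis using ZD[of r] card_mono[of "Z r"] finite_subset by (meson order_trans)
qed

text \<open>In a matching, \<open>u\<close> and its neighbours form a component \<open>X\<close>.
  The function that is 0 on \<open>X\<close> and infinite elsewhere is a potential, so nothing
  outside \<open>X\<close> has finite distance from \<open>u\<close>; the radius does not enter the
  bound.\<close>

lemma ball_matching:
  assumes "graph V E" "max_degree V E \<le> 1"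
  shows "card {x. hop_dist E u x \<le> enat r} \<le> 2"
proof -
  define X where "X = insert u {x. {x, u} \<in> E}"
  have X: "finite X" "card X \<le> 2" using card_neighbours_le[OF assms(1), of u] assms(2)
    by (auto simp: X_def card_insert_if)
  have unique: "a = b" if "{a, v} \<in> E" "{b, v} \<in> E" for a b v
  proof -
    have "card {x. {x, v} \<in> E} \<le> 1" "finite {x. {x, v} \<in> E}"
      using card_neighbours_le[OF assms(1), of v] assms(2) by auto
    then show ?thesis using that by (metis card_le_Suc0_iff_eq mem_Collect_eq One_nat_def)
  qed
  define f where "f = (\<lambda>x. if x \<in> X then 0 else \<infinity> :: enat)"
  have "f y \<le> f x + 1" if "{x, y} \<in> E" for x y
  proof -
    have "y \<in> X" if "x \<in> X"
      using that \<open>{x, y} \<in> E\<close> unique[of u x y] by (auto simp: X_def insert_commute)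
    then show ?thesis by (auto simp: f_def)
  qed
  then have "f x \<le> f u + hop_dist E u x" for x
    unfolding hop_dist_def by (rule potential_le_weighted_dist)
  moreover have "f u = 0" by (simp add: f_def X_def)
  ultimately have "f x \<le> hop_dist E u x" for x by (metis add_0)
  then have "f x \<noteq> \<infinity>" if "hop_dist E u x \<le> enat r" for x
    using that by (metis enat_ord_simps(5) infinity_ileE order_trans enat.distinct(1))
  then have "{x. hop_dist E u x \<le> enat r} \<subseteq> X"
    unfolding f_def by (metis (lifting) mem_Collect_eq subsetI)
  then show ?thesis using X card_mono order_trans by blast
qed

text \<open>For \<open>D \<ge> 2\<close> the growth rate satisfies \<open>D + 1 \<le> D * D\<close>,
  which gives the exponent \<open>2 * r\<close>. The leading 2 is the size of a ball in a matching,
  where the power is 1.\<close>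

lemma card_ball_le:
  assumes "graph V E"
  shows "finite {x. hop_dist E u x \<le> enat r}"
    "card {x. hop_dist E u x \<le> enat r} \<le> 2 * max 1 (max_degree V E) ^ (2 * r)"
proof -
  show "finite {x. hop_dist E u x \<le> enat r}" using ball_growth[OF assms] by blast
  show "card {x. hop_dist E u x \<le> enat r} \<le> 2 * max 1 (max_degree V E) ^ (2 * r)"
  proof (cases "max_degree V E \<le> 1")
    case True
    then show ?thesis using ball_matching[OF assms True, of u r] by (simp add: max_def)
  next
    case False
    define D where "D = max_degree V E"
    have D: "2 \<le> D" using False by (simp add: D_def)
    have "D + 1 \<le> D * 2" using D by simp
    also have "\<dots> \<le> D * D" using D by (intro mult_left_mono) auto
    finally have "(D + 1) ^ r \<le> (D * D) ^ r" by (intro power_mono) auto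
    also have "\<dots> = D ^ (2 * r)" by (simp add: power_mult power2_eq_square)
    finally show ?thesis using ball_growth[OF assms, of u r] D by (simp add: D_def[symmetric] max_def)
  qed
qed

section \<open>Bounded loop programs and their compilation\<close>

text \<open>An upper bound in place of the exact time of \<open>exec\<close> lets the two branches
  of a test share one bound and loops be estimated by the number of rounds.\<close>

definition runs :: "program \<Rightarrow> state \<Rightarrow> state \<Rightarrow> nat \<Rightarrow> bool" where
  "runs P s s' T \<longleftrightarrow> (\<exists>\<tau>\<le>T. exec P s \<tau> s')"

lemma runs_mono: "runs P s s' T \<Longrightarrow> T \<le> T' \<Longrightarrow> runs P s s' T'"
  unfolding runs_def using order_trans by blast

lemma runs_basic:
  "runs (LoadConst x a) (r, m) (r(x := a), m) 1"
  "runs (Add x y z) (r, m) (r(x := r y + r z), m) 1"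
  "runs (Sub x y z) (r, m) (r(x := r y - r z), m) 1"
  "runs (Load x y) (r, m) (r(x := m (r y)), m) 1"
  "runs (Store x y) (r, m) (r, m(r x := r y)) 1"
  unfolding runs_def by (blast intro: exec.intros)+

lemma runs_Seq: "runs P s s' T \<Longrightarrow> runs Q s' s'' T' \<Longrightarrow> runs (Seq P Q) s s'' (T + T')"
  unfolding runs_def by (meson add_mono exec.Seq)

lemma runs_IfNZ:
  assumes "fst s x \<noteq> 0 \<Longrightarrow> runs P s s' T" and "fst s x = 0 \<Longrightarrow> runs Q s s' T'"
  shows "runs (IfNZ x P Q) s s' (Suc (max T T'))"
proof (cases "fst s x = 0")
  case True
  then obtain \<tau> where "\<tau> \<le> T'" "exec Q s \<tau> s'" using assms(2) unfolding runs_def by blast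
  then show ?thesis unfolding runs_def using True exec.IfFalse[of s x Q \<tau> s' P]
    by (intro exI[of _ "Suc \<tau>"]) auto
next
  case False
  then obtain \<tau> where "\<tau> \<le> T" "exec P s \<tau> s'" using assms(1) unfolding runs_def by blast
  then show ?thesis unfolding runs_def using False exec.IfTrue[of s x P \<tau> s' Q]
    by (intro exI[of _ "Suc \<tau>"]) auto
qed

text \<open>The index \<open>q\<close> of the invariant is a variant that may drop by more than 1
  per round, so it bounds the number of rounds. Each round costs the body and one test; the last
  summand pays for the test that fails.\<close>

lemma runs_WhileNZ:
  assumes step: "\<And>q s. J q s \<Longrightarrow> fst s x \<noteq> 0 \<Longrightarrow> \<exists>q'<q. \<exists>s'. runs B s s' C \<and> J q' s'"
    and "J q s"
  shows "\<exists>q' s'. runs (WhileNZ x B) s s' (q * (C + 1) + 1) \<and> J q' s' \<and> fst s' x = 0"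
  using \<open>J q s\<close>
proof (induction q arbitrary: s rule: less_induct)
  case (less q)
  show ?case
  proof (cases "fst s x = 0")
    case True
    then have "runs (WhileNZ x B) s s (q * (C + 1) + 1)"
      unfolding runs_def by (intro exI[of _ 1] conjI exec.WhileFalse) auto
    then show ?thesis using less.prems True by blast
  next
    case False
    then obtain q1 s1 where 1: "q1 < q" "runs B s s1 C" "J q1 s1"
      using step[OF less.prems] by blast
    then obtain q2 s2 where 2: "runs (WhileNZ x B) s1 s2 (q1 * (C + 1) + 1)" "J q2 s2" "fst s2 x = 0"
      using less.IH by blast
    obtain \<tau>1 \<tau>2 where \<tau>: "\<tau>1 \<le> C" "exec B s \<tau>1 s1" "\<tau>2 \<le> q1 * (C + 1) + 1"
        "exec (WhileNZ x B) s1 \<tau>2 s2"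
      using 1(2) 2(1) unfolding runs_def by blast
    have "Suc q1 * (C + 1) \<le> q * (C + 1)" using 1(1) by (intro mult_right_mono) auto
    then have "Suc (\<tau>1 + \<tau>2) \<le> q * (C + 1) + 1" using \<tau>(1,3) by simp
    moreover have "exec (WhileNZ x B) s (Suc (\<tau>1 + \<tau>2)) s2"
      using False \<tau> by (intro exec.WhileTrue)
    ultimately show ?thesis unfolding runs_def using 2 by blast
  qed
qed

text \<open>\<open>TimesN\<close> multiplies by register 0 only. This is what row-major indexing
  needs, and on a machine without multiplication it costs a loop of \<open>n\<close>
  additions.\<close>

datatype expr =
    Lit nat
  | Reg nat
  | Plus expr expr
  | Minus expr expr
  | TimesN expr
  | Mem expr
  | Cond expr expr expr

text \<open>The number of rounds of \<open>For\<close> is always the content of register 0, so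
  running times depend on \<open>n\<close> and the code, never on the data.\<close>

datatype com =
    Assign nat expr
  | Write expr expr
  | Then com com
  | Test expr com com
  | For nat com

fun val :: "expr \<Rightarrow> state \<Rightarrow> nat" where
  "val (Lit a) s = a"
| "val (Reg x) s = fst s x"
| "val (Plus a b) s = val a s + val b s"
| "val (Minus a b) s = val a s - val b s"
| "val (TimesN a) s = val a s * fst s 0"
| "val (Mem a) s = snd s (val a s)"
| "val (Cond a b c) s = (if val a s \<noteq> 0 then val b s else val c s)"

definition set_reg :: "nat \<Rightarrow> nat \<Rightarrow> state \<Rightarrow> state" where
  "set_reg x a s = ((fst s)(x := a), snd s)"

lemma set_reg_simps [simp]: "fst (set_reg x a s) = (fst s)(x := a)" "snd (set_reg x a s) = snd s"
  by (simp_all add: set_reg_def)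

primrec sem :: "com \<Rightarrow> state \<Rightarrow> state" where
  "sem (Assign x e) = (\<lambda>s. set_reg x (val e s) s)"
| "sem (Write a e) = (\<lambda>s. (fst s, (snd s)(val a s := val e s)))"
| "sem (Then c d) = (\<lambda>s. sem d (sem c s))"
| "sem (Test e c d) = (\<lambda>s. if val e s \<noteq> 0 then sem c s else sem d s)"
| "sem (For i c) = (\<lambda>s. set_reg i 0 (fold (\<lambda>j s. sem c (set_reg i j s)) [0..<fst s 0] s))"

text \<open>Register 0 holds the bound of all loops, so it must not be assigned.\<close>

fun expr_below :: "nat \<Rightarrow> expr \<Rightarrow> bool" where
  "expr_below K (Lit a) \<longleftrightarrow> True"
| "expr_below K (Reg x) \<longleftrightarrow> x < K"
| "expr_below K (Plus a b) \<longleftrightarrow> expr_below K a \<and> expr_below K b"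
| "expr_below K (Minus a b) \<longleftrightarrow> expr_below K a \<and> expr_below K b"
| "expr_below K (TimesN a) \<longleftrightarrow> expr_below K a"
| "expr_below K (Mem a) \<longleftrightarrow> expr_below K a"
| "expr_below K (Cond a b c) \<longleftrightarrow> expr_below K a \<and> expr_below K b \<and> expr_below K c"

fun com_below :: "nat \<Rightarrow> com \<Rightarrow> bool" where
  "com_below K (Assign x e) \<longleftrightarrow> 0 < x \<and> x < K \<and> expr_below K e"
| "com_below K (Write a e) \<longleftrightarrow> expr_below K a \<and> expr_below K e"
| "com_below K (Then c d) \<longleftrightarrow> com_below K c \<and> com_below K d"
| "com_below K (Test e c d) \<longleftrightarrow> expr_below K e \<and> com_below K c \<and> com_below K d"
| "com_below K (For i c) \<longleftrightarrow> 0 < i \<and> i < K \<and> com_below K c"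

lemma val_cong:
  assumes "expr_below K e" "0 < K" "\<And>x. x < K \<Longrightarrow> r x = r' x"
  shows "val e (r, m) = val e (r', m)"
  using assms by (induction e) auto

lemma sem_reg_0: "com_below K c \<Longrightarrow> fst (sem c s) 0 = fst s 0"
proof (induction c arbitrary: s)
  case (For i c)
  have "fst (fold (\<lambda>j s. sem c (set_reg i j s)) xs s) 0 = fst s 0" for xs s
    using For by (induction xs arbitrary: s) auto
  then show ?case using For.prems by simp
qed auto

text \<open>Compiled code at level \<open>d\<close> uses the registers from \<open>d\<close> on as scratch space;
  the value of an expression ends up in register \<open>d\<close>.\<close>

fun compile_expr :: "nat \<Rightarrow> expr \<Rightarrow> program" where
  "compile_expr d (Lit a) = LoadConst d a"
| "compile_expr d (Reg x) = Seq (LoadConst d 0) (Add d d x)"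
| "compile_expr d (Plus a b) =
     Seq (compile_expr d a) (Seq (compile_expr (d + 1) b) (Add d d (d + 1)))"
| "compile_expr d (Minus a b) =
     Seq (compile_expr d a) (Seq (compile_expr (d + 1) b) (Sub d d (d + 1)))"
| "compile_expr d (TimesN a) =
     Seq (compile_expr d a)
     (Seq (LoadConst (d + 1) 0)
     (Seq (LoadConst (d + 2) 0)
     (Seq (Add (d + 2) (d + 2) 0)
     (Seq (LoadConst (d + 3) 1)
     (Seq (WhileNZ (d + 2) (Seq (Add (d + 1) (d + 1) d) (Sub (d + 2) (d + 2) (d + 3))))
     (Seq (LoadConst d 0) (Add d d (d + 1))))))))"
| "compile_expr d (Mem a) = Seq (compile_expr d a) (Load d d)"
| "compile_expr d (Cond a b c) =
     Seq (compile_expr d a) (IfNZ d (compile_expr d b) (compile_expr d c))"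

text \<open>For \<open>TimesN\<close>, each of the \<open>n\<close> rounds takes two instructions
  and a test; the 7 counts six instructions outside the loop and the failing test.\<close>

fun expr_time :: "expr \<Rightarrow> nat \<Rightarrow> nat" where
  "expr_time (Lit a) n = 1"
| "expr_time (Reg x) n = 2"
| "expr_time (Plus a b) n = expr_time a n + (expr_time b n + 1)"
| "expr_time (Minus a b) n = expr_time a n + (expr_time b n + 1)"
| "expr_time (TimesN a) n = expr_time a n + (3 * n + 7)"
| "expr_time (Mem a) n = expr_time a n + 1"
| "expr_time (Cond a b c) n = expr_time a n + Suc (max (expr_time b n) (expr_time c n))"

text \<open>Registers below the level stay intact. Hence the left operand, stored in register
  \<open>d\<close>, survives the evaluation of the right operand at level
  \<open>d + 1\<close>.\<close>

lemma compile_expr_correct: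
  assumes "expr_below K e" "K \<le> d" "0 < K"
  shows "\<exists>r'. runs (compile_expr d e) (r, m) (r', m) (expr_time e (r 0)) \<and>
      r' d = val e (r, m) \<and> (\<forall>x<d. r' x = r x)"
  using assms
proof (induction e arbitrary: d r)
  case (Lit a)
  have "runs (compile_expr d (Lit a)) (r, m) (r(d := a), m) (expr_time (Lit a) (r 0))"
    by (simp only: compile_expr.simps expr_time.simps runs_basic)
  moreover have "(r(d := a)) d = val (Lit a) (r, m) \<and> (\<forall>x<d. (r(d := a)) x = r x)" by simp
  ultimately show ?case by blast
next
  case (Reg x)
  define r1 where "r1 = r(d := 0)"
  define r2 where "r2 = r1(d := r1 d + r1 x)"
  have "runs (compile_expr d (Reg x)) (r, m) (r2, m) (1 + 1)"
    unfolding compile_expr.simps r2_def r1_def by (rule runs_Seq[OF runs_basic(1) runs_basic(2)])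
  then have "runs (compile_expr d (Reg x)) (r, m) (r2, m) (expr_time (Reg x) (r 0))"
    by (rule runs_mono) simp
  moreover have "r2 d = val (Reg x) (r, m) \<and> (\<forall>x<d. r2 x = r x)"
    using Reg by (auto simp: r1_def r2_def)
  ultimately show ?case by blast
next
  case (Plus a b)
  obtain r1 where r1: "runs (compile_expr d a) (r, m) (r1, m) (expr_time a (r 0))"
      "r1 d = val a (r, m)" "\<forall>x<d. r1 x = r x" using Plus.IH(1)[of d r] Plus.prems by auto
  obtain r2 where r2: "runs (compile_expr (d + 1) b) (r1, m) (r2, m) (expr_time b (r1 0))"
      "r2 (d + 1) = val b (r1, m)" "\<forall>x<d + 1. r2 x = r1 x" using Plus.IH(2)[of "d + 1" r1] Plus.prems by auto
  define r3 where "r3 = r2(d := r2 d + r2 (d + 1))"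
  have b: "val b (r1, m) = val b (r, m)" using Plus.prems r1(3) by (intro val_cong[of K]) auto
  have "r1 0 = r 0" using r1(3) Plus.prems by auto
  moreover have "runs (compile_expr d (Plus a b)) (r, m) (r3, m)
      (expr_time a (r 0) + (expr_time b (r1 0) + 1))"
    unfolding compile_expr.simps r3_def by (rule runs_Seq[OF r1(1) runs_Seq[OF r2(1) runs_basic(2)]])
  ultimately have "runs (compile_expr d (Plus a b)) (r, m) (r3, m) (expr_time (Plus a b) (r 0))" by simp
  moreover have "r3 d = val (Plus a b) (r, m) \<and> (\<forall>x<d. r3 x = r x)"
    using r1 r2 b by (auto simp: r3_def)
  ultimately show ?case by blast
next
  case (Minus a b)
  obtain r1 where r1: "runs (compile_expr d a) (r, m) (r1, m) (expr_time a (r 0))"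
      "r1 d = val a (r, m)" "\<forall>x<d. r1 x = r x" using Minus.IH(1)[of d r] Minus.prems by auto
  obtain r2 where r2: "runs (compile_expr (d + 1) b) (r1, m) (r2, m) (expr_time b (r1 0))"
      "r2 (d + 1) = val b (r1, m)" "\<forall>x<d + 1. r2 x = r1 x" using Minus.IH(2)[of "d + 1" r1] Minus.prems by auto
  define r3 where "r3 = r2(d := r2 d - r2 (d + 1))"
  have b: "val b (r1, m) = val b (r, m)" using Minus.prems r1(3) by (intro val_cong[of K]) auto
  have "r1 0 = r 0" using r1(3) Minus.prems by auto
  moreover have "runs (compile_expr d (Minus a b)) (r, m) (r3, m)
      (expr_time a (r 0) + (expr_time b (r1 0) + 1))"
    unfolding compile_expr.simps r3_def by (rule runs_Seq[OF r1(1) runs_Seq[OF r2(1) runs_basic(3)]])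
  ultimately have "runs (compile_expr d (Minus a b)) (r, m) (r3, m) (expr_time (Minus a b) (r 0))" by simp
  moreover have "r3 d = val (Minus a b) (r, m) \<and> (\<forall>x<d. r3 x = r x)"
    using r1 r2 b by (auto simp: r3_def)
  ultimately show ?case by blast
next
  case (TimesN a)
  obtain r1 where r1: "runs (compile_expr d a) (r, m) (r1, m) (expr_time a (r 0))"
      "r1 d = val a (r, m)" "\<forall>x<d. r1 x = r x" using TimesN.IH[of d r] TimesN.prems by auto
  define r2 where "r2 = r1(d + 1 := 0)"
  define r3 where "r3 = r2(d + 2 := 0)"
  define r4 where "r4 = r3(d + 2 := r3 (d + 2) + r3 0)"
  define r5 where "r5 = r4(d + 3 := 1)"
  \<comment> \<open>Register \<open>d + 1\<close> accumulates the product, \<open>d + 2\<close>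
    counts the additions still to be made, and \<open>d + 3\<close> holds the 1 for the
    decrement.\<close>
  define J where "J = (\<lambda>q (s :: state). snd s = m \<and> fst s (d + 2) = q \<and> fst s d = r1 d \<and>
      fst s (d + 3) = 1 \<and> fst s (d + 1) + r1 d * q = r1 d * r 0 \<and> (\<forall>x<d. fst s x = r x))"
  let ?B = "Seq (Add (d + 1) (d + 1) d) (Sub (d + 2) (d + 2) (d + 3))"
  have step: "\<exists>q'<q. \<exists>s'. runs ?B s s' (1 + 1) \<and> J q' s'" if J: "J q s" and nz: "fst s (d + 2) \<noteq> 0" for q s
  proof -
    obtain \<rho> where s: "s = (\<rho>, m)" using J[unfolded J_def] by (metis prod.collapse)
    obtain p where p: "q = Suc p" using J nz by (cases q) (auto simp: J_def)
    let ?r = "\<rho>(d + 1 := \<rho> (d + 1) + \<rho> d)"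
    have "runs ?B s (?r(d + 2 := ?r (d + 2) - ?r (d + 3)), m) (1 + 1)"
      unfolding s by (rule runs_Seq[OF runs_basic(2) runs_basic(3)])
    moreover have "J p (?r(d + 2 := ?r (d + 2) - ?r (d + 3)), m)"
      using J s p by (auto simp: J_def)
    ultimately show ?thesis using p by blast
  qed
  have "0 < d" using TimesN.prems by auto
  then have "J (r 0) (r5, m)" using r1 by (auto simp: J_def r2_def r3_def r4_def r5_def)
  from runs_WhileNZ[where J = J, OF step this]
  obtain q r6 m' where r6': "runs (WhileNZ (d + 2) ?B) (r5, m) (r6, m') (r 0 * (1 + 1 + 1) + 1)"
      "J q (r6, m')" "r6 (d + 2) = 0" by (metis surj_pair fst_conv)
  then have [simp]: "m' = m" by (simp add: J_def)
  note r6 = r6'[unfolded \<open>m' = m\<close>]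
  define r7 where "r7 = r6(d := 0)"
  have "runs (compile_expr d (TimesN a)) (r, m) (r7(d := r7 d + r7 (d + 1)), m)
      (expr_time a (r 0) + (1 + (1 + (1 + (1 + ((r 0 * (1 + 1 + 1) + 1) + (1 + 1)))))))"
    unfolding compile_expr.simps r7_def
    by (rule runs_Seq[OF r1(1) runs_Seq[OF runs_basic(1) runs_Seq[OF runs_basic(1)
          runs_Seq[OF runs_basic(2) runs_Seq[OF runs_basic(1)
          runs_Seq[OF r6(1)[unfolded r5_def r4_def r3_def r2_def] runs_Seq[OF runs_basic(1) runs_basic(2)]]]]]]])
  then have "runs (compile_expr d (TimesN a)) (r, m) (r7(d := r7 d + r7 (d + 1)), m)
      (expr_time (TimesN a) (r 0))" by (rule runs_mono) simp
  moreover have "(r7(d := r7 d + r7 (d + 1))) d = val (TimesN a) (r, m) \<and>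
      (\<forall>x<d. (r7(d := r7 d + r7 (d + 1))) x = r x)"
    using r6 r1(2) by (auto simp: J_def r7_def)
  ultimately show ?case by blast
next
  case (Mem a)
  obtain r1 where r1: "runs (compile_expr d a) (r, m) (r1, m) (expr_time a (r 0))"
      "r1 d = val a (r, m)" "\<forall>x<d. r1 x = r x" using Mem.IH[of d r] Mem.prems by auto
  have "runs (compile_expr d (Mem a)) (r, m) (r1(d := m (r1 d)), m) (expr_time a (r 0) + 1)"
    unfolding compile_expr.simps by (rule runs_Seq[OF r1(1) runs_basic(4)])
  moreover have "(r1(d := m (r1 d))) d = val (Mem a) (r, m) \<and> (\<forall>x<d. (r1(d := m (r1 d))) x = r x)"
    using r1 by auto
  ultimately show ?case unfolding expr_time.simps by blast
next
  case (Cond a b c)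
  obtain r1 where r1: "runs (compile_expr d a) (r, m) (r1, m) (expr_time a (r 0))"
      "r1 d = val a (r, m)" "\<forall>x<d. r1 x = r x" using Cond.IH(1)[of d r] Cond.prems by auto
  obtain r2 where r2: "runs (compile_expr d b) (r1, m) (r2, m) (expr_time b (r1 0))"
      "r2 d = val b (r1, m)" "\<forall>x<d. r2 x = r1 x" using Cond.IH(2)[of d r1] Cond.prems by auto
  obtain r3 where r3: "runs (compile_expr d c) (r1, m) (r3, m) (expr_time c (r1 0))"
      "r3 d = val c (r1, m)" "\<forall>x<d. r3 x = r1 x" using Cond.IH(3)[of d r1] Cond.prems by auto
  have eq: "val b (r1, m) = val b (r, m)" "val c (r1, m) = val c (r, m)"
    using Cond.prems r1(3) by (auto intro!: val_cong[of K])
  have "r1 0 = r 0" using r1(3) Cond.prems by auto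
  moreover have "runs (compile_expr d (Cond a b c)) (r, m) (if r1 d \<noteq> 0 then r2 else r3, m)
      (expr_time a (r 0) + Suc (max (expr_time b (r1 0)) (expr_time c (r1 0))))"
    unfolding compile_expr.simps
    by (rule runs_Seq[OF r1(1) runs_IfNZ]) (use r2 r3 in auto)
  ultimately have "runs (compile_expr d (Cond a b c)) (r, m) (if r1 d \<noteq> 0 then r2 else r3, m)
      (expr_time (Cond a b c) (r 0))"
    by simp
  moreover have "(if r1 d \<noteq> 0 then r2 else r3) d = val (Cond a b c) (r, m) \<and>
      (\<forall>x<d. (if r1 d \<noteq> 0 then r2 else r3) x = r x)"
    using r1 r2 r3 eq by auto
  ultimately show ?case by blast
qed

text \<open>A \<open>For\<close> loop keeps the number of remaining rounds in register
  \<open>d\<close>, the true counter in \<open>d + 1\<close> and the constant 1 in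
  \<open>d + 2\<close>, so its body is compiled at level \<open>d + 3\<close>. The visible counter
  \<open>i\<close> is a copy renewed in each round.\<close>

fun compile :: "nat \<Rightarrow> com \<Rightarrow> program" where
  "compile d (Assign x e) = Seq (compile_expr d e) (Seq (LoadConst x 0) (Add x x d))"
| "compile d (Write a e) = Seq (compile_expr d a) (Seq (compile_expr (d + 1) e) (Store d (d + 1)))"
| "compile d (Then b c) = Seq (compile d b) (compile d c)"
| "compile d (Test e b c) = Seq (compile_expr d e) (IfNZ d (compile d b) (compile d c))"
| "compile d (For i c) =
     Seq (LoadConst d 0)
     (Seq (Add d d 0)
     (Seq (LoadConst (d + 1) 0)
     (Seq (WhileNZ d
        (Seq (LoadConst i 0)
        (Seq (Add i i (d + 1))
        (Seq (compile (d + 3) c)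
        (Seq (LoadConst (d + 2) 1)
        (Seq (Add (d + 1) (d + 1) (d + 2)) (Sub d d (d + 2))))))))
     (LoadConst i 0))))"

text \<open>A round of \<open>For\<close> spends five instructions and a test besides its body;
  outside the rounds there are four instructions and the failing test.\<close>

fun com_time :: "com \<Rightarrow> nat \<Rightarrow> nat" where
  "com_time (Assign x e) n = expr_time e n + (1 + 1)"
| "com_time (Write a e) n = expr_time a n + (expr_time e n + 1)"
| "com_time (Then b c) n = com_time b n + com_time c n"
| "com_time (Test e b c) n = expr_time e n + Suc (max (com_time b n) (com_time c n))"
| "com_time (For i c) n = n * (com_time c n + 6) + 5"

text \<open>The machine registers \<open>\<rho>\<close> agree with the source state only below
  \<open>K\<close>. The last clause protects the registers between \<open>K\<close> and
  \<open>d\<close>, where the enclosing loops keep their counters; it is what carries the induction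
  through \<open>For\<close>.\<close>

lemma compile_correct:
  assumes "com_below K c" "K \<le> d" "0 < K" "\<forall>x<K. \<rho> x = fst s x"
  shows "\<exists>\<rho>'. runs (compile d c) (\<rho>, snd s) (\<rho>', snd (sem c s)) (com_time c (fst s 0)) \<and>
      (\<forall>x<K. \<rho>' x = fst (sem c s) x) \<and> (\<forall>x. K \<le> x \<longrightarrow> x < d \<longrightarrow> \<rho>' x = \<rho> x)"
  using assms
proof (induction c arbitrary: d \<rho> s)
  case (Assign y e)
  obtain r m where s: "s = (r, m)" by (cases s)
  obtain r1 where r1: "runs (compile_expr d e) (\<rho>, m) (r1, m) (expr_time e (\<rho> 0))"
      "r1 d = val e (\<rho>, m)" "\<forall>x<d. r1 x = \<rho> x"
    using compile_expr_correct[of K e d \<rho> m] Assign by auto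
  have "val e (\<rho>, m) = val e (r, m)" using Assign.prems by (intro val_cong[of K]) (auto simp: s)
  moreover have "\<rho> 0 = r 0" using Assign.prems s by auto
  ultimately have v: "r1 d = val e s" "\<rho> 0 = fst s 0" using r1(2) s by auto
  define r2 where "r2 = r1(y := 0)"
  define r3 where "r3 = r2(y := r2 y + r2 d)"
  have "runs (compile d (Assign y e)) (\<rho>, m) (r3, m) (expr_time e (\<rho> 0) + (1 + 1))"
    using runs_Seq[OF r1(1) runs_Seq[OF runs_basic(1)[of y 0] runs_basic(2)[of y y d]]]
    by (simp only: compile.simps r2_def r3_def)
  then have "runs (compile d (Assign y e)) (\<rho>, snd s) (r3, snd (sem (Assign y e) s))
      (com_time (Assign y e) (fst s 0))"
    by (simp add: s v[unfolded s])
  moreover have "\<forall>x<K. r3 x = fst (sem (Assign y e) s) x" "\<forall>x. K \<le> x \<longrightarrow> x < d \<longrightarrow> r3 x = \<rho> x"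
    using v Assign.prems r1(3) by (auto simp: r3_def r2_def)
  ultimately show ?case by blast
next
  case (Write a e)
  obtain r m where s: "s = (r, m)" by (cases s)
  obtain r1 where r1: "runs (compile_expr d a) (\<rho>, m) (r1, m) (expr_time a (\<rho> 0))"
      "r1 d = val a (\<rho>, m)" "\<forall>x<d. r1 x = \<rho> x"
    using compile_expr_correct[of K a d \<rho> m] Write by auto
  obtain r2 where r2: "runs (compile_expr (d + 1) e) (r1, m) (r2, m) (expr_time e (r1 0))"
      "r2 (d + 1) = val e (r1, m)" "\<forall>x<d + 1. r2 x = r1 x"
    using compile_expr_correct[of K e "d + 1" r1 m] Write by auto
  have "val a (\<rho>, m) = val a (r, m)" "val e (r1, m) = val e (r, m)"
    using Write.prems r1(3) by (auto intro!: val_cong[of K] simp: s)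
  moreover have "\<rho> 0 = r 0" "r1 0 = r 0" using Write.prems s r1(3) by auto
  moreover have "runs (compile d (Write a e)) (\<rho>, m) (r2, m(r2 d := r2 (d + 1)))
      (expr_time a (\<rho> 0) + (expr_time e (r1 0) + 1))"
    unfolding compile.simps by (rule runs_Seq[OF r1(1) runs_Seq[OF r2(1) runs_basic(5)]])
  ultimately have "runs (compile d (Write a e)) (\<rho>, snd s) (r2, snd (sem (Write a e) s))
      (com_time (Write a e) (fst s 0))"
    using r1(2,3) r2(2,3) by (simp add: s)
  moreover have "\<forall>x<K. r2 x = fst (sem (Write a e) s) x"
    "\<forall>x. K \<le> x \<longrightarrow> x < d \<longrightarrow> r2 x = \<rho> x"
    using Write.prems r1(3) r2(3) by auto
  ultimately show ?case by blast
next
  case (Then b c)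
  obtain r1 where r1: "runs (compile d b) (\<rho>, snd s) (r1, snd (sem b s)) (com_time b (fst s 0))"
      "\<forall>x<K. r1 x = fst (sem b s) x" "\<forall>x. K \<le> x \<longrightarrow> x < d \<longrightarrow> r1 x = \<rho> x"
    using Then.IH(1)[of d \<rho> s] Then.prems by auto
  obtain r2 where r2: "runs (compile d c) (r1, snd (sem b s)) (r2, snd (sem c (sem b s)))
        (com_time c (fst (sem b s) 0))"
      "\<forall>x<K. r2 x = fst (sem c (sem b s)) x" "\<forall>x. K \<le> x \<longrightarrow> x < d \<longrightarrow> r2 x = r1 x"
    using Then.IH(2)[of d r1 "sem b s"] Then.prems r1 by auto
  have "fst (sem b s) 0 = fst s 0" using sem_reg_0[of K b s] Then.prems by simp
  then have "runs (compile d (Then b c)) (\<rho>, snd s) (r2, snd (sem (Then b c) s))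
      (com_time (Then b c) (fst s 0))"
    using runs_Seq[OF r1(1) r2(1)] by simp
  then show ?case using r1 r2 by (intro exI[of _ r2]) auto
next
  case (Test e b c)
  obtain r m where s: "s = (r, m)" by (cases s)
  obtain r1 where r1: "runs (compile_expr d e) (\<rho>, m) (r1, m) (expr_time e (\<rho> 0))"
      "r1 d = val e (\<rho>, m)" "\<forall>x<d. r1 x = \<rho> x"
    using compile_expr_correct[of K e d \<rho> m] Test by auto
  have v: "val e (\<rho>, m) = val e (r, m)" "\<rho> 0 = r 0"
    using Test.prems by (auto intro!: val_cong[of K] simp: s)
  obtain r2 where r2: "runs (compile d b) (r1, m) (r2, snd (sem b s)) (com_time b (r 0))"
      "\<forall>x<K. r2 x = fst (sem b s) x" "\<forall>x. K \<le> x \<longrightarrow> x < d \<longrightarrow> r2 x = r1 x"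
    using Test.IH(1)[of d r1 s] Test.prems r1 s by auto
  obtain r3 where r3: "runs (compile d c) (r1, m) (r3, snd (sem c s)) (com_time c (r 0))"
      "\<forall>x<K. r3 x = fst (sem c s) x" "\<forall>x. K \<le> x \<longrightarrow> x < d \<longrightarrow> r3 x = r1 x"
    using Test.IH(2)[of d r1 s] Test.prems r1 s by auto
  have "runs (compile d (Test e b c)) (\<rho>, m)
      (if r1 d \<noteq> 0 then r2 else r3, snd (sem (if r1 d \<noteq> 0 then b else c) s))
      (expr_time e (\<rho> 0) + Suc (max (com_time b (r 0)) (com_time c (r 0))))"
    unfolding compile.simps by (rule runs_Seq[OF r1(1) runs_IfNZ]) (use r2 r3 in auto)
  then have "runs (compile d (Test e b c)) (\<rho>, snd s)
      (if r1 d \<noteq> 0 then r2 else r3, snd (sem (Test e b c) s)) (com_time (Test e b c) (fst s 0))"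
    using r1(2) v s by (simp split: if_splits)
  moreover have "\<forall>x<K. (if r1 d \<noteq> 0 then r2 else r3) x = fst (sem (Test e b c) s) x"
    "\<forall>x. K \<le> x \<longrightarrow> x < d \<longrightarrow> (if r1 d \<noteq> 0 then r2 else r3) x = \<rho> x"
    using r1 r2 r3 v s by auto
  ultimately show ?case by blast
next
  case (For i c)
  define n where "n = fst s 0"
  define it where "it = (\<lambda>a. fold (\<lambda>j s. sem c (set_reg i j s)) [0..<a] s)"
  have it_Suc: "it (Suc a) = sem c (set_reg i a (it a))" for a by (simp add: it_def)
  have it0: "fst (it a) 0 = n" for a
    using For.prems by (induction a) (simp_all add: it_Suc sem_reg_0[of K] n_def, simp add: it_def)
  let ?B = "Seq (LoadConst i 0) (Seq (Add i i (d + 1)) (Seq (compile (d + 3) c)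
        (Seq (LoadConst (d + 2) 1) (Seq (Add (d + 1) (d + 1) (d + 2)) (Sub d d (d + 2))))))"
  \<comment> \<open>With \<open>q\<close> rounds remaining, the machine mirrors the source state
    \<open>it (n - q)\<close> after \<open>n - q\<close> rounds.\<close>
  define J where "J = (\<lambda>q (t :: state). q \<le> n \<and> fst t d = q \<and> fst t (d + 1) = n - q \<and>
      snd t = snd (it (n - q)) \<and> (\<forall>x<K. fst t x = fst (it (n - q)) x) \<and>
      (\<forall>x. K \<le> x \<longrightarrow> x < d \<longrightarrow> fst t x = \<rho> x))"
  have step: "\<exists>q'<q. \<exists>t'. runs ?B t t' (1 + (1 + (com_time c n + (1 + (1 + 1))))) \<and> J q' t'"
    if J: "J q t" and nz: "fst t d \<noteq> 0" for q t
  proof -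
    obtain r m where t: "t = (r, m)" by (cases t)
    obtain p where p: "q = Suc p" using J nz by (cases q) (auto simp: J_def)
    define a where "a = n - q"
    have a: "n - p = Suc a" using J nz p by (auto simp: J_def a_def)
    define r1 where "r1 = r(i := 0)"
    define r2 where "r2 = r1(i := r1 i + r1 (d + 1))"
    have r2: "r2 x = (if x = i then a else r x)" for x
      using J nz t For.prems by (auto simp: r1_def r2_def J_def a_def)
    have "m = snd (set_reg i a (it a))" using J nz t by (simp add: J_def a_def)
    moreover have "\<forall>x<K. r2 x = fst (set_reg i a (it a)) x"
      using J nz t r2 by (auto simp: J_def a_def)
    ultimately obtain r3 where r3:
        "runs (compile (d + 3) c) (r2, m) (r3, snd (it (Suc a))) (com_time c n)"
        "\<forall>x<K. r3 x = fst (it (Suc a)) x" "\<forall>x. K \<le> x \<longrightarrow> x < d + 3 \<longrightarrow> r3 x = r2 x"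
      using For.IH[of "d + 3" r2 "set_reg i a (it a)"] For.prems it0[of a]
      by (auto simp: it_Suc)
    define r4 where "r4 = r3(d + 2 := 1)"
    define r5 where "r5 = r4(d + 1 := r4 (d + 1) + r4 (d + 2))"
    define r6 where "r6 = r5(d := r5 d - r5 (d + 2))"
    have "runs ?B t (r6, snd (it (Suc a))) (1 + (1 + (com_time c n + (1 + (1 + 1)))))"
      unfolding t r6_def r5_def r4_def
      by (rule runs_Seq[OF runs_basic(1) runs_Seq[OF runs_basic(2)
            runs_Seq[OF r3(1)[unfolded r2_def r1_def]
            runs_Seq[OF runs_basic(1) runs_Seq[OF runs_basic(2) runs_basic(3)]]]]])
    moreover have "J p (r6, snd (it (Suc a)))"
      using J r3 r2 For.prems p a t
      by (auto simp: J_def r6_def r5_def r4_def a_def)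
    ultimately show ?thesis using p by blast
  qed
  define r1 where "r1 = \<rho>(d := 0)"
  define r2 where "r2 = r1(d := r1 d + r1 0)"
  define r3 where "r3 = r2(d + 1 := 0)"
  have "J n (r3, snd s)" using For.prems
    by (auto simp: J_def r1_def r2_def r3_def it_def n_def)
  from runs_WhileNZ[where J = J, OF step this]
  obtain q r4 m4 where r4: "runs (WhileNZ d ?B) (r3, snd s) (r4, m4)
        (n * (1 + (1 + (com_time c n + (1 + (1 + 1)))) + 1) + 1)" "J q (r4, m4)" "r4 d = 0"
    by (metis surj_pair fst_conv)
  have "q = 0" using r4 by (simp add: J_def)
  then have m4: "m4 = snd (it n)" using r4 by (simp add: J_def)
  have "runs (compile d (For i c)) (\<rho>, snd s) (r4(i := 0), m4)
      (1 + (1 + (1 + ((n * (1 + (1 + (com_time c n + (1 + (1 + 1)))) + 1) + 1) + 1))))"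
    unfolding compile.simps
    by (rule runs_Seq[OF runs_basic(1) runs_Seq[OF runs_basic(2) runs_Seq[OF runs_basic(1)
            runs_Seq[OF r4(1)[unfolded r3_def r2_def r1_def] runs_basic(1)]]]])
  then have "runs (compile d (For i c)) (\<rho>, snd s) (r4(i := 0), m4) (com_time (For i c) n)"
    by (rule runs_mono) (simp add: algebra_simps)
  then have "runs (compile d (For i c)) (\<rho>, snd s) (r4(i := 0), snd (sem (For i c) s))
      (com_time (For i c) (fst s 0))"
    using m4 by (simp add: it_def n_def)
  moreover have "\<forall>x<K. (r4(i := 0)) x = fst (sem (For i c) s) x"
    "\<forall>x. K \<le> x \<longrightarrow> x < d \<longrightarrow> (r4(i := 0)) x = \<rho> x"
    using r4(2) \<open>q = 0\<close> For.prems by (auto simp: J_def it_def n_def)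
  ultimately show ?case by blast
qed

section \<open>Polynomial running time of loop programs\<close>

text \<open>The exponent \<open>p + q\<close> is a crude common bound for both exponents;
  \<open>1 \<le> n\<close> makes powers increase with the exponent.\<close>

lemma poly_bound_add:
  assumes "\<And>n. 1 \<le> n \<Longrightarrow> f n \<le> C * n ^ p" "\<And>n. 1 \<le> n \<Longrightarrow> g n \<le> D * n ^ q"
    and "1 \<le> (n :: nat)"
  shows "f n + g n \<le> (C + D) * n ^ (p + q)"
proof -
  have "n ^ p \<le> n ^ (p + q)" "n ^ q \<le> n ^ (p + q)" using assms(3) by (auto intro: power_increasing)
  then have "C * n ^ p + D * n ^ q \<le> C * n ^ (p + q) + D * n ^ (p + q)"
    by (intro add_mono mult_left_mono) auto
  then show ?thesis using assms(1)[OF assms(3)] assms(2)[OF assms(3)] by (simp add: algebra_simps)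
qed

text \<open>The loops of nested \<open>TimesN\<close> run one after the other, never inside each
  other, so a linear bound persists.\<close>

lemma expr_time_bound: "\<exists>C. \<forall>n\<ge>1. expr_time e n \<le> C * n"
proof (induction e)
  case (Plus a b)
  then obtain C D where "\<forall>n\<ge>1. expr_time a n \<le> C * n" "\<forall>n\<ge>1. expr_time b n \<le> D * n" by blast
  then show ?case by (intro exI[of _ "C + D + 1"]) (fastforce simp: algebra_simps)
next
  case (Minus a b)
  then obtain C D where "\<forall>n\<ge>1. expr_time a n \<le> C * n" "\<forall>n\<ge>1. expr_time b n \<le> D * n" by blast
  then show ?case by (intro exI[of _ "C + D + 1"]) (fastforce simp: algebra_simps)
next
  case (TimesN a)
  then obtain C where "\<forall>n\<ge>1. expr_time a n \<le> C * n" by blast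
  then show ?case by (intro exI[of _ "C + 10"]) (fastforce simp: algebra_simps)
next
  case (Mem a)
  then obtain C where "\<forall>n\<ge>1. expr_time a n \<le> C * n" by blast
  then show ?case by (intro exI[of _ "C + 1"]) (fastforce simp: algebra_simps)
next
  case (Cond a b c)
  then obtain C D E where "\<forall>n\<ge>1. expr_time a n \<le> C * n" "\<forall>n\<ge>1. expr_time b n \<le> D * n"
    "\<forall>n\<ge>1. expr_time c n \<le> E * n" by blast
  then show ?case by (intro exI[of _ "C + D + E + 1"]) (fastforce simp: algebra_simps max_def)
next
  case (Lit a) show ?case by (intro exI[of _ 1]) simp
next
  case (Reg x) show ?case by (intro exI[of _ 2]) simp
qed

text \<open>Only \<open>For\<close> multiplies the time, once by \<open>n\<close>. Neither
  \<open>T\<close> nor \<open>k\<close> occurs in \<open>com_time\<close>, and this is why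
  \<open>c\<^sub>0\<close> and \<open>c\<^sub>3\<close> can be chosen before
  \<open>t\<close>.\<close>

lemma com_time_bound: "\<exists>C p. \<forall>n\<ge>1. com_time c n \<le> C * n ^ p"
proof (induction c)
  case (Assign x e)
  obtain C where "\<forall>n\<ge>1. expr_time e n \<le> C * n" using expr_time_bound by blast
  then show ?case by (intro exI[of _ "C + 2"] exI[of _ 1]) (fastforce simp: algebra_simps)
next
  case (Write a e)
  obtain C D where "\<forall>n\<ge>1. expr_time a n \<le> C * n" "\<forall>n\<ge>1. expr_time e n \<le> D * n"
    using expr_time_bound by meson
  then show ?case by (intro exI[of _ "C + D + 1"] exI[of _ 1]) (fastforce simp: algebra_simps)
next
  case (Then b c)
  then obtain C p D q where "\<forall>n\<ge>1. com_time b n \<le> C * n ^ p" "\<forall>n\<ge>1. com_time c n \<le> D * n ^ q"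
    by blast
  then have "\<forall>n\<ge>1. com_time (Then b c) n \<le> (C + D) * n ^ (p + q)"
    using poly_bound_add[of "com_time b" C p "com_time c" D q] by simp
  then show ?case by blast
next
  case (Test e b c)
  then obtain C p D q where b: "\<forall>n\<ge>1. com_time b n \<le> C * n ^ p"
    and c: "\<forall>n\<ge>1. com_time c n \<le> D * n ^ q" by blast
  obtain E where e: "\<forall>n\<ge>1. expr_time e n \<le> E * n" using expr_time_bound by blast
  have 1: "expr_time e n + 1 \<le> (E + 1) * n ^ 1" if "1 \<le> n" for n
    using e that by (fastforce simp: algebra_simps)
  have 2: "com_time b n + com_time c n \<le> (C + D) * n ^ (p + q)" if "1 \<le> n" for n
    using poly_bound_add[of "com_time b" C p "com_time c" D q] b c that by simp
  have "com_time (Test e b c) n \<le> (E + 1 + (C + D)) * n ^ (1 + (p + q))" if "1 \<le> n" for n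
    using poly_bound_add[of "\<lambda>n. expr_time e n + 1" "E + 1" 1 "\<lambda>n. com_time b n + com_time c n",
        OF 1 2 that] by simp
  then show ?case by blast
next
  case (For i c)
  then obtain C p where "\<forall>n\<ge>1. com_time c n \<le> C * n ^ p" by blast
  then have "com_time c n + 6 \<le> (C + 6) * n ^ (p + 0)" if "1 \<le> n" for n
    using poly_bound_add[of "com_time c" C p "\<lambda>_. 6" 6 0] that by simp
  then have "n * (com_time c n + 6) \<le> n * ((C + 6) * n ^ p)" if "1 \<le> n" for n
    using that by (intro mult_left_mono) auto
  then have 1: "n * (com_time c n + 6) \<le> (C + 6) * n ^ Suc p" if "1 \<le> n" for n
    using that by (metis mult.left_commute power_Suc)
  have "com_time (For i c) n \<le> (C + 6 + 5) * n ^ (Suc p + 0)" if "1 \<le> n" for n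
    using poly_bound_add[of "\<lambda>n. n * (com_time c n + 6)" "C + 6" "Suc p" "\<lambda>_. 5" 5 0, OF 1 _ that]
    by simp
  then show ?case by blast
qed

section \<open>The search program\<close>

primrec assigned :: "com \<Rightarrow> nat set" where
  "assigned (Assign x e) = {x}"
| "assigned (Write a e) = {}"
| "assigned (Then c d) = assigned c \<union> assigned d"
| "assigned (Test e c d) = assigned c \<union> assigned d"
| "assigned (For i c) = insert i (assigned c)"

lemma sem_unassigned: "x \<notin> assigned c \<Longrightarrow> fst (sem c s) x = fst s x"
proof (induction c arbitrary: s)
  case (For i c)
  have "fst (fold (\<lambda>j s. sem c (set_reg i j s)) xs s) x = fst s x" for xs s
    using For by (induction xs arbitrary: s) auto
  then show ?case using For.prems by simp
qed auto

lemma sem_For_induct: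
  assumes "I 0 s" and "\<And>q t. q < fst s 0 \<Longrightarrow> I q t \<Longrightarrow> I (Suc q) (sem c (set_reg i q t))"
  obtains t where "sem (For i c) s = set_reg i 0 t" "I (fst s 0) t"
proof -
  let ?it = "\<lambda>q. fold (\<lambda>j s. sem c (set_reg i j s)) [0..<q] s"
  have "q \<le> fst s 0 \<Longrightarrow> I q (?it q)" for q
    using assms by (induction q) auto
  then show ?thesis using that[of "?it (fst s 0)"] by simp
qed

text \<open>Two nested loops are treated as a single one over the row-major index
  \<open>q = i * n + j\<close>. The condition on \<open>set_reg\<close> demands an invariant that
  ignores the counters, because they are reset between rows and at the end.\<close>

lemma sem_For_For_induct:
  assumes ij: "i \<noteq> 0" "i \<noteq> j" "0 \<notin> assigned c" "i \<notin> assigned c" "j \<noteq> 0"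
    and n: "fst s 0 = n" and I0: "I 0 s"
    and step: "\<And>q t. q < n * n \<Longrightarrow> fst t 0 = n \<Longrightarrow> fst t i = q div n \<Longrightarrow> fst t j = q mod n \<Longrightarrow>
      I q t \<Longrightarrow> I (Suc q) (sem c t)"
    and reg: "\<And>q x a t. x \<in> {i, j} \<Longrightarrow> I q t \<Longrightarrow> I q (set_reg x a t)"
  shows "I (n * n) (sem (For i (For j c)) s)"
proof -
  define J where "J = (\<lambda>q t. fst t 0 = n \<and> I (q * n) t)"
  have J0: "J 0 s" using I0 n by (simp add: J_def)
  have outer: "J (Suc q) (sem (For j c) (set_reg i q t))" if q: "q < fst s 0" and J: "J q t" for q t
  proof -
    define t1 where "t1 = set_reg i q t"
    have t1: "fst t1 0 = n" using J ij by (simp add: t1_def J_def)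
    define L where "L = (\<lambda>k t. fst t 0 = n \<and> fst t i = q \<and> I (q * n + k) t)"
    have L0: "L 0 t1" using J reg[of i "q * n" t q] ij by (simp add: t1_def L_def J_def)
    have inner: "L (Suc k) (sem c (set_reg j k t'))" if k: "k < fst t1 0" and L: "L k t'" for k t'
    proof -
      have kn: "k < n" using k t1 by simp
      have "q * n + k < Suc q * n" using kn by simp
      also have "\<dots> \<le> n * n" using q n by (intro mult_right_mono) auto
      finally have "I (Suc (q * n + k)) (sem c (set_reg j k t'))"
        using kn L ij reg[of j _ t'] by (intro step) (auto simp: L_def)
      then show ?thesis using L ij by (auto simp: L_def sem_unassigned)
    qed
    obtain t2 where "sem (For j c) t1 = set_reg j 0 t2" "L (fst t1 0) t2"
      by (rule sem_For_induct[of L t1 c j, OF L0 inner])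
    then show ?thesis using t1 ij reg[of j _ t2 0] unfolding t1_def[symmetric]
      by (auto simp: L_def J_def add.commute)
  qed
  obtain t where "sem (For i (For j c)) s = set_reg i 0 t" "J (fst s 0) t"
    by (rule sem_For_induct[of J s "For j c" i, OF J0 outer])
  then show ?thesis using reg[of i _ t 0] n by (simp add: J_def)
qed

definition mat :: "nat \<Rightarrow> (nat \<Rightarrow> nat) \<Rightarrow> nat \<Rightarrow> (nat \<Rightarrow> nat \<Rightarrow> nat) \<Rightarrow> bool" where
  "mat n m b D \<longleftrightarrow> (\<forall>x<n. \<forall>y<n. m (b + (x * n + y)) = D x y)"

definition idx :: "expr \<Rightarrow> nat \<Rightarrow> nat \<Rightarrow> expr" where
  "idx b x y = Plus b (Plus (TimesN (Reg x)) (Reg y))"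

definition fill :: "nat \<Rightarrow> nat \<Rightarrow> expr \<Rightarrow> expr \<Rightarrow> com" where
  "fill i j b e = For i (For j (Write (idx b i j) e))"

lemma val_idx [simp]: "val (idx b x y) s = val b s + (fst s x * fst s 0 + fst s y)"
  by (simp add: idx_def)

lemma assigned_fill [simp]: "assigned (fill i j b e) = {i, j}"
  by (auto simp: fill_def)

lemma index_less: "x < n \<Longrightarrow> y < n \<Longrightarrow> x * n + y < n * (n :: nat)"
  using mult_right_mono[of "x + 1" n n] by simp

text \<open>The entry expression is evaluated while the block is partly overwritten. So
  \<open>entry\<close> may rely on the memory outside the block and on registers other than the
  counters, but not on the block itself.\<close>

lemma sem_fill:
  assumes ij: "i \<noteq> 0" "j \<noteq> 0" "i \<noteq> j" and n: "fst s 0 = n"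
    and base: "\<And>t. \<forall>x. x \<noteq> i \<longrightarrow> x \<noteq> j \<longrightarrow> fst t x = fst s x \<Longrightarrow> val b t = B"
    and entry: "\<And>t x y. \<forall>x. x \<noteq> i \<longrightarrow> x \<noteq> j \<longrightarrow> fst t x = fst s x \<Longrightarrow> fst t i = x \<Longrightarrow> fst t j = y \<Longrightarrow>
      x < n \<Longrightarrow> y < n \<Longrightarrow> \<forall>a. a < B \<or> B + n * n \<le> a \<longrightarrow> snd t a = snd s a \<Longrightarrow> val e t = D x y"
  shows "mat n (snd (sem (fill i j b e) s)) B D \<and>
    (\<forall>a. a < B \<or> B + n * n \<le> a \<longrightarrow> snd (sem (fill i j b e) s) a = snd s a)"
proof -
  define I where "I = (\<lambda>q t. (\<forall>x. x \<noteq> i \<longrightarrow> x \<noteq> j \<longrightarrow> fst t x = fst s x) \<and>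
      (\<forall>a. a < B \<or> B + n * n \<le> a \<longrightarrow> snd t a = snd s a) \<and>
      (\<forall>p<q. snd t (B + p) = D (p div n) (p mod n)))"
  have "I (n * n) (sem (For i (For j (Write (idx b i j) e))) s)"
  proof (rule sem_For_For_induct[of i j _ s n I])
    fix q t assume q: "q < n * n" "fst t 0 = n" "fst t i = q div n" "fst t j = q mod n" and I: "I q t"
    have "val b t = B" using I by (intro base) (simp add: I_def)
    moreover have "0 < n" using q(1) by (cases n) auto
    then have "q div n < n" "q mod n < n" using q(1) by (auto simp: less_mult_imp_div_less)
    then have "val e t = D (q div n) (q mod n)" using I q by (intro entry) (auto simp: I_def)
    ultimately show "I (Suc q) (sem (Write (idx b i j) e) t)"
      using I q by (auto simp: I_def less_Suc_eq)
  qed (use ij n in \<open>auto simp: I_def\<close>)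
  then have I: "I (n * n) (sem (fill i j b e) s)" by (simp add: fill_def)
  have "snd (sem (fill i j b e) s) (B + (x * n + y)) = D x y" if "x < n" "y < n" for x y
  proof -
    have "snd (sem (fill i j b e) s) (B + (x * n + y)) = D ((x * n + y) div n) ((x * n + y) mod n)"
      using I index_less[OF that] by (simp add: I_def)
    then show ?thesis using that by simp
  qed
  then show ?thesis using I unfolding I_def mat_def by blast
qed

section \<open>Truncated all-pairs distances\<close>

fun floyd_warshall :: "nat \<Rightarrow> (nat \<Rightarrow> nat \<Rightarrow> nat) \<Rightarrow> nat \<Rightarrow> nat \<Rightarrow> nat" where
  "floyd_warshall 0 D x y = D x y"
| "floyd_warshall (Suc l) D x y =
     min (floyd_warshall l D x y) (floyd_warshall l D x l + floyd_warshall l D l y)"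

lemma floyd_warshall_le: "floyd_warshall l D x y \<le> D x y"
  by (induction l arbitrary: x y) (auto simp: min_le_iff_disj)

text \<open>Entries in row and column \<open>l\<close> do not grow in round \<open>l\<close>, which
  settles \<open>m = l\<close>. For \<open>m < l\<close> the two minima on the right give four sums,
  and the previous inequalities through \<open>m\<close> for the pairs \<open>x y\<close>,
  \<open>x l\<close>, \<open>l y\<close> and \<open>l l\<close> bound them from below.\<close>

lemma floyd_warshall_triangle:
  "m < l \<Longrightarrow> floyd_warshall l D x y \<le> floyd_warshall l D x m + floyd_warshall l D m y"
proof (induction l arbitrary: x y)
  case (Suc l)
  let ?F = "floyd_warshall l D"
  show ?case
  proof (cases "m = l")
    case True
    then show ?thesis by (simp add: min_def)
  next
    case False
    then have "?F a c \<le> ?F a m + ?F m c" for a c using Suc by simp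
    from this[of x y] this[of x l] this[of l y] this[of l l] show ?thesis by (simp add: min_def)
  qed
qed simp

lemma floyd_warshall_ge:
  assumes "\<And>x y z. (b x z :: enat) \<le> b x y + b y z" "\<And>x y. b x y \<le> enat (D x y)"
  shows "b x y \<le> enat (floyd_warshall l D x y)"
proof (induction l arbitrary: x y)
  case (Suc l)
  have "b x y \<le> enat (floyd_warshall l D x l) + enat (floyd_warshall l D l y)"
    using assms(1)[of x y l] Suc by (meson add_mono order_trans)
  then show ?case using Suc[of x y] by (simp add: min_def)
qed (use assms in simp)

text \<open>\<open>Suc T\<close> plays the part of infinity: memory cells hold naturals, and
  distances above \<open>T\<close> need not be told apart.\<close>

definition truncated_weight ::
    "nat \<Rightarrow> (nat \<Rightarrow> nat \<Rightarrow> enat) \<Rightarrow> nat set set \<Rightarrow> nat \<Rightarrow> nat \<Rightarrow> nat" where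
  "truncated_weight T w E x y = (if x = y then 0
     else if {x, y} \<in> E then the_enat (min (w x y) (enat (Suc T))) else Suc T)"

lemma enat_the_enat_min: "enat (the_enat (min z (enat a))) = min z (enat a)"
  by (cases z) (auto simp: min_def)

text \<open>Both inequalities avoid decomposing walks. Row \<open>u\<close> of the result obeys the
  triangle inequality, so it is a potential and lies below the distance; conversely the truncated
  distance is a subadditive function below the initial matrix, and \<open>floyd_warshall_ge\<close>
  keeps it below the result.\<close>

lemma floyd_warshall_weighted_dist:
  assumes E: "graph {..<n} E"
  shows "enat (floyd_warshall n (truncated_weight T w E) u v) = min (weighted_dist w E u v) (enat (Suc T))"
proof (rule antisym)
  let ?W = "truncated_weight T w E"
  let ?F = "floyd_warshall n ?W"
  have "?W u v \<le> Suc T"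
    using enat_the_enat_min[of "w u v" "Suc T"]
    by (cases "w u v") (auto simp: truncated_weight_def min_def)
  then have "?F u v \<le> Suc T" using floyd_warshall_le order_trans by blast
  have "enat (?F u y) \<le> enat (?F u x) + w x y" if xy: "{x, y} \<in> E" for x y
  proof -
    have "x < n" "x \<noteq> y" using xy E by (auto simp: graph_def vertex_pairs_def doubleton_eq_iff)
    then have "?F u y \<le> ?F u x + ?F x y" by (intro floyd_warshall_triangle)
    also have "\<dots> \<le> ?F u x + ?W x y" by (simp add: floyd_warshall_le)
    finally have "enat (?F u y) \<le> enat (?F u x) + enat (?W x y)" by simp
    also have "enat (?W x y) \<le> w x y"
      using xy \<open>x \<noteq> y\<close> by (simp add: truncated_weight_def enat_the_enat_min)
    finally show ?thesis by simp
  qed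
  from potential_le_weighted_dist[of E "\<lambda>v. enat (?F u v)" w v u, OF this]
  have "enat (?F u v) \<le> enat (?F u u) + weighted_dist w E u v" .
  moreover have "?F u u = 0" using floyd_warshall_le[of n ?W u u] by (simp add: truncated_weight_def)
  ultimately show "enat (?F u v) \<le> min (weighted_dist w E u v) (enat (Suc T))"
    using \<open>?F u v \<le> Suc T\<close> by (simp add: zero_enat_def[symmetric])
  show "min (weighted_dist w E u v) (enat (Suc T)) \<le> enat (?F u v)"
  proof (rule floyd_warshall_ge)
    fix x y z
    have "weighted_dist w E x z \<le> weighted_dist w E x y + weighted_dist w E y z"
      by (rule weighted_dist_triangle)
    then show "min (weighted_dist w E x z) (enat (Suc T)) \<le>
        min (weighted_dist w E x y) (enat (Suc T)) + min (weighted_dist w E y z) (enat (Suc T))"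
      by (cases "weighted_dist w E x y"; cases "weighted_dist w E y z"; cases "weighted_dist w E x z")
        (auto simp: min_def)
  next
    fix x y
    show "min (weighted_dist w E x y) (enat (Suc T)) \<le> enat (?W x y)"
      using weighted_dist_edge[of x y E w] enat_the_enat_min[of "w x y" "Suc T"]
      by (auto simp: truncated_weight_def zero_enat_def[symmetric] simp del: enat_ord_simps
          intro: min.coboundedI1 min.mono)
  qed
qed

text \<open>Register 3 holds \<open>n\<^sup>2\<close>; the \<open>k\<close>-th block of that length starts at \<open>k * n\<^sup>2\<close>.
  Block 0 holds \<open>G\<close>, block 1 \<open>\<Gamma>\<close>, block 2 the distances in \<open>\<Gamma>\<close>, block 3 those in the current
  graph, and block 4 is scratch space. From block 5 on follows the queue,
  whose entries consist of an adjacency matrix and a remaining budget and are never freed.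
  The other registers are: 0 for \<open>n\<close>, 1 for \<open>k\<close>, 2 for \<open>T\<close>, 4 and 5 for the head and the tail of the
  queue, 6 for the loop flag, 7 for the answer, 8 to 12 for loop counters, 13 for \<open>u + 1\<close> where \<open>u\<close>
  lies on a violated edge (0 if there is none), and 14 for \<open>u\<close>.\<close>

primrec block :: "nat \<Rightarrow> expr" where
  "block 0 = Lit 0"
| "block (Suc k) = Plus (block k) (Reg 3)"

lemma val_block [simp]: "val (block k) s = k * fst s 3"
  by (induction k) auto

text \<open>With truncated subtraction, \<open>a - (a - b)\<close> is the minimum of
  \<open>a\<close> and \<open>b\<close>. A round is computed in block 4 and copied back, since
  \<open>sem_fill\<close> does not allow reading the block being filled.\<close>

definition floyd :: "nat \<Rightarrow> com" where
  "floyd k = For 10 (Then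
     (fill 8 9 (block 4) (Minus (Mem (idx (block k) 8 9)) (Minus (Mem (idx (block k) 8 9))
        (Plus (Mem (idx (block k) 8 10)) (Mem (idx (block k) 10 9))))))
     (fill 8 9 (block k) (Mem (idx (block 4) 8 9))))"

lemma assigned_floyd [simp]: "assigned (floyd k) = {8, 9, 10}"
  by (auto simp: floyd_def)

lemma matD: "mat n m b D \<Longrightarrow> x < n \<Longrightarrow> y < n \<Longrightarrow> m (b + (x * n + y)) = D x y"
  by (simp add: mat_def)

text \<open>The bound \<open>k < 4\<close> separates the matrix from the scratch block 4. The queue,
  which starts at block 5, is among the cells left unchanged.\<close>

lemma sem_floyd:
  assumes n: "fst s 0 = n" "fst s 3 = n * n" and k: "k < 4"
    and D: "mat n (snd s) (k * (n * n)) D"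
  shows "mat n (snd (sem (floyd k) s)) (k * (n * n)) (floyd_warshall n D)"
    and "a < k * (n * n) \<or> 5 * (n * n) \<le> a \<Longrightarrow> snd (sem (floyd k) s) a = snd s a"
proof -
  let ?N = "n * n"
  have kN: "k * ?N + ?N \<le> 4 * ?N" using mult_right_mono[of "k + 1" 4 ?N] k by simp
  define I where "I = (\<lambda>q (t :: state). fst t 0 = n \<and> fst t 3 = ?N \<and>
      (\<forall>a. a < k * ?N \<or> 5 * ?N \<le> a \<longrightarrow> snd t a = snd s a) \<and>
      mat n (snd t) (k * ?N) (floyd_warshall q D))"
  have I0: "I 0 s" using n D by (simp add: I_def mat_def)
  let ?e1 = "Minus (Mem (idx (block k) 8 9)) (Minus (Mem (idx (block k) 8 9))
        (Plus (Mem (idx (block k) 8 10)) (Mem (idx (block k) 10 9))))"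
  let ?e2 = "Mem (idx (block 4) 8 9)"
  let ?B = "Then (fill 8 9 (block 4) ?e1) (fill 8 9 (block k) ?e2)"
  have step: "I (Suc q) (sem ?B (set_reg 10 q t))" if q: "q < fst s 0" and I: "I q t" for q t
  proof -
    define t1 where "t1 = set_reg 10 q t"
    let ?D = "floyd_warshall q D" and ?D' = "floyd_warshall (Suc q) D"
    have t1: "fst t1 0 = n" "fst t1 3 = ?N" "fst t1 10 = q" "mat n (snd t1) (k * ?N) ?D"
      using I by (auto simp: t1_def I_def)
    define t2 where "t2 = sem (fill 8 9 (block 4) ?e1) t1"
    have t2: "fst t2 0 = n" "fst t2 3 = ?N"
      using t1 by (auto simp: t2_def sem_unassigned)
    have 1: "mat n (snd t2) (4 * ?N) ?D' \<and>
        (\<forall>a. a < 4 * ?N \<or> 4 * ?N + ?N \<le> a \<longrightarrow> snd t2 a = snd t1 a)"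
      unfolding t2_def
    proof (rule sem_fill)
      fix t' :: state and x y :: nat
      assume *: "\<forall>x. x \<noteq> 8 \<longrightarrow> x \<noteq> 9 \<longrightarrow> fst t' x = fst t1 x" "fst t' 8 = x" "fst t' 9 = y"
        "x < n" "y < n" "\<forall>a. a < 4 * ?N \<or> 4 * ?N + ?N \<le> a \<longrightarrow> snd t' a = snd t1 a"
      have D: "snd t' (k * ?N + (a * n + b)) = ?D a b" if "a < n" "b < n" for a b
      proof -
        have "k * ?N + (a * n + b) < 4 * ?N" using index_less[OF that] kN by linarith
        then show ?thesis using *(6) matD[OF t1(4) that] by simp
      qed
      show "val ?e1 t' = ?D' x y" using * t1 D q n by (simp add: min_def)
    qed (use t1 in auto)
    define t3 where "t3 = sem (fill 8 9 (block k) ?e2) t2"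
    have 2: "mat n (snd t3) (k * ?N) ?D' \<and>
        (\<forall>a. a < k * ?N \<or> k * ?N + ?N \<le> a \<longrightarrow> snd t3 a = snd t2 a)"
      unfolding t3_def
    proof (rule sem_fill)
      fix t' :: state and x y :: nat
      assume *: "\<forall>x. x \<noteq> 8 \<longrightarrow> x \<noteq> 9 \<longrightarrow> fst t' x = fst t2 x" "fst t' 8 = x" "fst t' 9 = y"
        "x < n" "y < n" "\<forall>a. a < k * ?N \<or> k * ?N + ?N \<le> a \<longrightarrow> snd t' a = snd t2 a"
      have "k * ?N + ?N \<le> 4 * ?N + (x * n + y)" using kN by linarith
      then show "val ?e2 t' = ?D' x y" using * t2 matD[OF conjunct1[OF 1] *(4,5)] by simp
    qed (use t2 in auto)
    have "fst t3 0 = n" "fst t3 3 = ?N" using t2 by (auto simp: t3_def sem_unassigned)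
    moreover have "snd t3 a = snd s a" if "a < k * ?N \<or> 5 * ?N \<le> a" for a
    proof -
      have "snd t3 a = snd t2 a" using that kN by (intro conjunct2[OF 2, rule_format]) linarith
      also have "\<dots> = snd t1 a" using that kN by (intro conjunct2[OF 1, rule_format]) linarith
      finally show ?thesis using I that by (auto simp: I_def t1_def)
    qed
    ultimately have "I (Suc q) t3" using 2 by (simp add: I_def)
    then show ?thesis by (simp add: t3_def t2_def t1_def)
  qed
  obtain t where "sem (floyd k) s = set_reg 10 0 t" "I (fst s 0) t"
    unfolding floyd_def by (rule sem_For_induct[of I s ?B 10, OF I0 step])
  then show "mat n (snd (sem (floyd k) s)) (k * ?N) (floyd_warshall n D)"
    and "a < k * ?N \<or> 5 * ?N \<le> a \<Longrightarrow> snd (sem (floyd k) s) a = snd s a"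
    using n by (auto simp: I_def)
qed

text \<open>Of the two truncated differences at least one vanishes, so their sum is the absolute
  difference.\<close>

definition eq_expr :: "expr \<Rightarrow> expr \<Rightarrow> expr" where
  "eq_expr a b = Minus (Lit 1) (Plus (Minus a b) (Minus b a))"

lemma val_eq_expr [simp]: "val (eq_expr a b) s = (if val a s = val b s then 1 else 0)"
  by (simp add: eq_expr_def)

definition adj :: "nat \<Rightarrow> (nat \<Rightarrow> nat) \<Rightarrow> nat \<Rightarrow> nat set set \<Rightarrow> bool" where
  "adj n m b E \<longleftrightarrow> (\<forall>x<n. \<forall>y<n. m (b + (x * n + y)) \<noteq> 0 \<longleftrightarrow> {x, y} \<in> E)"

lemma adjD: "adj n m b E \<Longrightarrow> x < n \<Longrightarrow> y < n \<Longrightarrow> m (b + (x * n + y)) \<noteq> 0 \<longleftrightarrow> {x, y} \<in> E"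
  by (simp add: adj_def)

lemma mat_cong:
  assumes "\<And>a. b \<le> a \<Longrightarrow> a < b + n * n \<Longrightarrow> m' a = m a"
  shows "mat n m' b D \<longleftrightarrow> mat n m b D" "adj n m' b E \<longleftrightarrow> adj n m b E"
  using assms index_less by (simp_all add: mat_def adj_def)

definition hops :: "nat \<Rightarrow> nat \<Rightarrow> nat set set \<Rightarrow> nat \<Rightarrow> nat \<Rightarrow> nat" where
  "hops n T E = floyd_warshall n (truncated_weight T (\<lambda>_ _. 1) E)"

definition dists :: "nat \<Rightarrow> nat \<Rightarrow> nat set set \<Rightarrow> nat set set \<Rightarrow> nat \<Rightarrow> nat \<Rightarrow> nat" where
  "dists n T E\<^sub>\<Gamma> E = floyd_warshall n (truncated_weight T (hop_dist E\<^sub>\<Gamma>) E)"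

lemma min_Suc_le_iff: "enat a = min z (enat (Suc T)) \<Longrightarrow> a \<le> T \<longleftrightarrow> z \<le> enat T"
  by (cases z) (auto simp: min_def split: if_splits)

lemma hops_le_iff: "graph {..<n} E \<Longrightarrow> hops n T E u v \<le> T \<longleftrightarrow> hop_dist E u v \<le> enat T"
  unfolding hops_def hop_dist_def by (rule min_Suc_le_iff) (rule floyd_warshall_weighted_dist)

lemma dists_le_iff:
  "graph {..<n} E \<Longrightarrow> dists n T E\<^sub>\<Gamma> E u v \<le> T \<longleftrightarrow> weighted_dist (hop_dist E\<^sub>\<Gamma>) E u v \<le> enat T"
  unfolding dists_def by (rule min_Suc_le_iff) (rule floyd_warshall_weighted_dist)

text \<open>The truncated distances of \<Gamma> computed in block 2 can serve directly as the
  truncated edge weights of the current graph, without access to the exact hop distances.\<close>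

lemma truncated_weight_hop_dist:
  assumes "graph {..<n} E\<^sub>\<Gamma>"
  shows "truncated_weight T (hop_dist E\<^sub>\<Gamma>) E x y =
    (if x = y then 0 else if {x, y} \<in> E then hops n T E\<^sub>\<Gamma> x y else Suc T)"
  using floyd_warshall_weighted_dist[OF assms, of T "\<lambda>_ _. 1" x y]
  by (auto simp: truncated_weight_def hops_def hop_dist_def) (metis the_enat.simps)

lemma truncated_weight_1:
  "truncated_weight T (\<lambda>_ _. 1) E x y = (if x = y then 0 else if {x, y} \<in> E then 1 else Suc T)"
  by (simp add: truncated_weight_def one_enat_def min_def)

section \<open>Memory invariant and queue\<close>

text \<open>This is the part of the state that stays fixed once \<open>init\<close> has run; it
  involves only memory below block 3.\<close>

definition env :: "nat \<Rightarrow> nat \<Rightarrow> nat set set \<Rightarrow> state \<Rightarrow> bool" where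
  "env n T E\<^sub>\<Gamma> s \<longleftrightarrow> fst s 0 = n \<and> fst s 2 = T \<and> fst s 3 = n * n \<and>
     adj n (snd s) (n * n) E\<^sub>\<Gamma> \<and> mat n (snd s) (2 * (n * n)) (hops n T E\<^sub>\<Gamma>)"

lemma env_cong:
  assumes "env n T E\<^sub>\<Gamma> s" "fst t 0 = fst s 0" "fst t 2 = fst s 2" "fst t 3 = fst s 3"
    and "\<And>a. a < 3 * (n * n) \<Longrightarrow> snd t a = snd s a"
  shows "env n T E\<^sub>\<Gamma> t"
proof -
  have "adj n (snd t) (n * n) E\<^sub>\<Gamma> \<longleftrightarrow> adj n (snd s) (n * n) E\<^sub>\<Gamma>"
    using assms(5) by (intro mat_cong) simp
  moreover have "mat n (snd t) (2 * (n * n)) D \<longleftrightarrow> mat n (snd s) (2 * (n * n)) D" for D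
    using assms(5) by (intro mat_cong) simp
  ultimately show ?thesis using assms by (simp add: env_def)
qed

fun node :: "nat \<Rightarrow> (nat \<Rightarrow> nat) \<Rightarrow> nat \<Rightarrow> nat set set \<times> nat \<Rightarrow> bool" where
  "node n m p (E, j) \<longleftrightarrow> adj n m p E \<and> m (p + n * n) = j"

fun queue :: "nat \<Rightarrow> (nat \<Rightarrow> nat) \<Rightarrow> nat \<Rightarrow> (nat set set \<times> nat) list \<Rightarrow> nat \<Rightarrow> bool" where
  "queue n m p [] q \<longleftrightarrow> p = q"
| "queue n m p (x # xs) q \<longleftrightarrow> node n m p x \<and> queue n m (p + (n * n + 1)) xs q"

lemma queue_append:
  "queue n m p (xs @ ys) q \<longleftrightarrow> (\<exists>p'. queue n m p xs p' \<and> queue n m p' ys q)"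
  by (induction xs arbitrary: p) auto

lemma queue_le: "queue n m p xs q \<Longrightarrow> p \<le> q \<and> (xs \<noteq> [] \<longrightarrow> p + (n * n + 1) \<le> q)"
  by (induction xs arbitrary: p) fastforce+

lemma node_cong:
  "node n m p x \<Longrightarrow> (\<And>a. p \<le> a \<Longrightarrow> a < p + (n * n + 1) \<Longrightarrow> m' a = m a) \<Longrightarrow> node n m' p x"
  using mat_cong(2)[of p n m' m] by (cases x) auto

lemma queue_cong:
  "queue n m p xs q \<Longrightarrow> (\<And>a. p \<le> a \<Longrightarrow> a < q \<Longrightarrow> m' a = m a) \<Longrightarrow> queue n m' p xs q"
proof (induction xs arbitrary: p)
  case (Cons x xs)
  then have q: "queue n m (p + (n * n + 1)) xs q" and x: "node n m p x" by auto
  have le: "p + (n * n + 1) \<le> q" using queue_le[OF q] by simp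
  have "node n m' p x" using x by (rule node_cong) (use Cons.prems(2) le in auto)
  moreover have "queue n m' (p + (n * n + 1)) xs q" using q by (rule Cons.IH) (use Cons.prems(2) in auto)
  ultimately show ?case by simp
qed simp

section \<open>Code for the initialisation and for one search node\<close>

definition init :: com where
  "init = Then (Assign 3 (TimesN (Reg 0)))
    (Then (fill 8 9 (block 2) (Cond (eq_expr (Reg 8) (Reg 9)) (Lit 0)
       (Cond (Mem (idx (block 1) 8 9)) (Lit 1) (Plus (Reg 2) (Lit 1)))))
    (Then (floyd 2)
    (Then (Assign 4 (block 5))
    (Then (fill 8 9 (Reg 4) (Mem (idx (Lit 0) 8 9)))
    (Then (Write (Plus (Reg 4) (Reg 3)) (Reg 1))
    (Then (Assign 5 (Plus (Reg 4) (Plus (Reg 3) (Lit 1))))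
    (Assign 6 (Lit 1))))))))"

definition relax :: com where
  "relax = Then (fill 8 9 (block 3) (Cond (eq_expr (Reg 8) (Reg 9)) (Lit 0)
       (Cond (Mem (idx (Reg 4) 8 9)) (Mem (idx (block 2) 8 9)) (Plus (Reg 2) (Lit 1)))))
     (floyd 3)"

text \<open>Of the violated edge only \<open>u\<close> is recorded, because the candidate pairs
  depend on the ball around \<open>u\<close> alone.\<close>

definition find_conflict :: com where
  "find_conflict = Then (Assign 13 (Lit 0)) (For 8 (For 9 (Assign 13
     (Cond (Mem (idx (block 1) 8 9))
       (Cond (Minus (Mem (idx (block 3) 8 9)) (Reg 2)) (Plus (Reg 8) (Lit 1)) (Reg 13))
       (Reg 13)))))"

text \<open>\<open>Plus\<close> acts as disjunction and \<open>Cond\<close> with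
  \<open>Lit 0\<close> as conjunction. The test covers both orders of the new pair, which keeps the
  stored matrix symmetric.\<close>

definition push_child :: com where
  "push_child = Then (fill 8 9 (Reg 5)
       (Cond (Plus (Cond (eq_expr (Reg 8) (Reg 11)) (eq_expr (Reg 9) (Reg 12)) (Lit 0))
                   (Cond (eq_expr (Reg 8) (Reg 12)) (eq_expr (Reg 9) (Reg 11)) (Lit 0)))
          (Lit 1) (Mem (idx (Reg 4) 8 9))))
     (Then (Write (Plus (Reg 5) (Reg 3)) (Minus (Mem (Plus (Reg 4) (Reg 3))) (Lit 1)))
     (Assign 5 (Plus (Reg 5) (Plus (Reg 3) (Lit 1)))))"

text \<open>\<open>Assign 13 (Reg 13)\<close> serves as a no-op.\<close>

definition push_children :: com where
  "push_children = For 11 (For 12 (Test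
     (Cond (Minus (Reg 12) (Reg 11))
       (Cond (Minus (Plus (Reg 2) (Lit 1)) (Mem (idx (block 2) 14 11)))
         (Minus (Plus (Reg 2) (Lit 1)) (Mem (idx (block 2) 14 12))) (Lit 0)) (Lit 0))
     push_child (Assign 13 (Reg 13))))"

text \<open>The head is advanced before the flag is computed, so the flag is the number of memory
  cells still queued. A violated node with budget 0 is dropped without children.\<close>

definition process_node :: com where
  "process_node = Then relax (Then find_conflict (Test (Reg 13)
     (Then (Assign 14 (Minus (Reg 13) (Lit 1)))
     (Then (Test (Mem (Plus (Reg 4) (Reg 3))) push_children (Assign 13 (Reg 13)))
     (Then (Assign 4 (Plus (Reg 4) (Plus (Reg 3) (Lit 1))))
     (Assign 6 (Minus (Reg 5) (Reg 4))))))
     (Then (Assign 7 (Lit 1)) (Assign 6 (Lit 0)))))"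

section \<open>Effect of the code\<close>

lemma sem_init:
  assumes G: "graph {..<n} E\<^sub>\<Gamma>" and s: "fst s 0 = n" "fst s 1 = k" "fst s 2 = T" "fst s 7 = 0"
    and m: "adj n (snd s) 0 E\<^sub>G" "adj n (snd s) (n * n) E\<^sub>\<Gamma>"
  defines "s' \<equiv> sem init s"
  shows "env n T E\<^sub>\<Gamma> s' \<and> fst s' 4 = 5 * (n * n) \<and> fst s' 6 = 1 \<and> fst s' 7 = 0 \<and>
    queue n (snd s') (5 * (n * n)) [(E\<^sub>G, k)] (fst s' 5)"
proof -
  let ?N = "n * n"
  define t1 where "t1 = set_reg 3 ?N s"
  let ?e = "Cond (eq_expr (Reg 8) (Reg 9)) (Lit 0)
       (Cond (Mem (idx (block 1) 8 9)) (Lit 1) (Plus (Reg 2) (Lit 1)))"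
  define t2 where "t2 = sem (fill 8 9 (block 2) ?e) t1"
  have 2: "mat n (snd t2) (2 * ?N) (truncated_weight T (\<lambda>_ _. 1) E\<^sub>\<Gamma>) \<and>
      (\<forall>a. a < 2 * ?N \<or> 2 * ?N + ?N \<le> a \<longrightarrow> snd t2 a = snd t1 a)"
    unfolding t2_def
  proof (rule sem_fill)
    fix t' :: state and x y :: nat
    assume *: "\<forall>x. x \<noteq> 8 \<longrightarrow> x \<noteq> 9 \<longrightarrow> fst t' x = fst t1 x" "fst t' 8 = x" "fst t' 9 = y"
      "x < n" "y < n" "\<forall>a. a < 2 * ?N \<or> 2 * ?N + ?N \<le> a \<longrightarrow> snd t' a = snd t1 a"
    have "snd t' (?N + (x * n + y)) = snd s (?N + (x * n + y))"
      using *(6) index_less[OF *(4,5)] by (simp add: t1_def)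
    then show "val ?e t' = truncated_weight T (\<lambda>_ _. 1) E\<^sub>\<Gamma> x y"
      using * adjD[OF m(2) *(4,5)] s by (simp add: t1_def truncated_weight_1)
  qed (use s in \<open>auto simp: t1_def\<close>)
  have t2: "fst t2 x = (if x = 3 then ?N else fst s x)" if "x \<notin> {8, 9}" for x
    using that by (simp add: t2_def sem_unassigned t1_def)
  define t3 where "t3 = sem (floyd 2) t2"
  have 3: "mat n (snd t3) (2 * ?N) (hops n T E\<^sub>\<Gamma>)"
    unfolding t3_def hops_def using 2 t2 s by (intro sem_floyd) auto
  have m3: "snd t3 a = snd s a" if "a < 2 * ?N \<or> 5 * ?N \<le> a" for a
  proof -
    have "snd t3 a = snd t2 a"
      unfolding t3_def using that t2 s 2 by (intro sem_floyd) auto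
    also have "\<dots> = snd s a" using 2 that by (auto simp: t1_def)
    finally show ?thesis .
  qed
  have t3: "fst t3 x = (if x = 3 then ?N else fst s x)" if "x \<notin> {8, 9, 10}" for x
    using that t2 by (simp add: t3_def sem_unassigned)
  define t4 where "t4 = set_reg 4 (5 * ?N) t3"
  define t5 where "t5 = sem (fill 8 9 (Reg 4) (Mem (idx (Lit 0) 8 9))) t4"
  have 5: "mat n (snd t5) (5 * ?N) (\<lambda>x y. snd s (x * n + y)) \<and>
      (\<forall>a. a < 5 * ?N \<or> 5 * ?N + ?N \<le> a \<longrightarrow> snd t5 a = snd t4 a)"
    unfolding t5_def
  proof (rule sem_fill)
    fix t' :: state and x y :: nat
    assume *: "\<forall>x. x \<noteq> 8 \<longrightarrow> x \<noteq> 9 \<longrightarrow> fst t' x = fst t4 x" "fst t' 8 = x" "fst t' 9 = y"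
      "x < n" "y < n" "\<forall>a. a < 5 * ?N \<or> 5 * ?N + ?N \<le> a \<longrightarrow> snd t' a = snd t4 a"
    have "x * n + y < ?N" using index_less *(4,5) by simp
    then have "snd t' (x * n + y) = snd s (x * n + y)"
      using *(6) m3[of "x * n + y"] by (simp add: t4_def)
    then show "val (Mem (idx (Lit 0) 8 9)) t' = snd s (x * n + y)"
      using * s t3 by (simp add: t4_def)
  qed (use s t3 in \<open>auto simp: t4_def\<close>)
  have t5: "fst t5 x = (if x = 3 then ?N else if x = 4 then 5 * ?N else fst s x)" if "x \<notin> {8, 9, 10}" for x
    using that t3 by (simp add: t5_def sem_unassigned t4_def)
  have s': "s' = set_reg 6 1 (set_reg 5 (5 * ?N + (?N + 1)) (fst t5, (snd t5)(5 * ?N + ?N := k)))"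
  proof -
    have e1: "sem (Assign 3 (TimesN (Reg 0))) s = t1" by (simp add: t1_def s)
    have e4: "sem (Assign 4 (block 5)) t3 = t4" using t3 by (simp add: t4_def)
    have "s' = sem (Assign 6 (Lit 1)) (sem (Assign 5 (Plus (Reg 4) (Plus (Reg 3) (Lit 1))))
        (sem (Write (Plus (Reg 4) (Reg 3)) (Reg 1)) t5))"
      by (simp only: s'_def init_def sem.simps(3) e1 e4 t2_def[symmetric] t3_def[symmetric] t5_def[symmetric])
    then show ?thesis using t5 s by simp
  qed
  have "adj n (snd t5) (5 * ?N) E\<^sub>G" using 5 m(1) by (simp add: adj_def mat_def)
  moreover have "adj n (snd s') (5 * ?N) E\<^sub>G \<longleftrightarrow> adj n (snd t5) (5 * ?N) E\<^sub>G"
    by (rule mat_cong) (simp add: s')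
  moreover have "snd s' (5 * ?N + ?N) = k" by (simp add: s')
  moreover have mem: "snd s' a = snd t3 a" if "a < 3 * ?N" for a
    using that 5 by (simp add: s' t4_def)
  have "adj n (snd s') ?N E\<^sub>\<Gamma> \<longleftrightarrow> adj n (snd s) ?N E\<^sub>\<Gamma>"
    using mem m3 by (intro mat_cong) simp
  moreover have "mat n (snd s') (2 * ?N) (hops n T E\<^sub>\<Gamma>) \<longleftrightarrow> mat n (snd t3) (2 * ?N) (hops n T E\<^sub>\<Gamma>)"
    using mem by (intro mat_cong) simp
  ultimately show ?thesis using m 3 t5 s by (simp add: env_def s')
qed

text \<open>The matrix of the node lies beyond block 4, so it can still be read while block 3 is
  being filled.\<close>

lemma sem_relax:
  assumes \<Gamma>: "graph {..<n} E\<^sub>\<Gamma>" and env: "env n T E\<^sub>\<Gamma> s"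
    and p: "5 * (n * n) \<le> fst s 4" "adj n (snd s) (fst s 4) E"
  defines "s' \<equiv> sem relax s"
  shows "mat n (snd s') (3 * (n * n)) (dists n T E\<^sub>\<Gamma> E)"
    and "a < 3 * (n * n) \<or> 5 * (n * n) \<le> a \<Longrightarrow> snd s' a = snd s a"
    and "x \<notin> {8, 9, 10} \<Longrightarrow> fst s' x = fst s x"
proof -
  let ?N = "n * n"
  let ?e = "Cond (eq_expr (Reg 8) (Reg 9)) (Lit 0)
       (Cond (Mem (idx (Reg 4) 8 9)) (Mem (idx (block 2) 8 9)) (Plus (Reg 2) (Lit 1)))"
  define t where "t = sem (fill 8 9 (block 3) ?e) s"
  have 1: "mat n (snd t) (3 * ?N) (truncated_weight T (hop_dist E\<^sub>\<Gamma>) E) \<and>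
      (\<forall>a. a < 3 * ?N \<or> 3 * ?N + ?N \<le> a \<longrightarrow> snd t a = snd s a)"
    unfolding t_def
  proof (rule sem_fill)
    fix t' :: state and x y :: nat
    assume *: "\<forall>x. x \<noteq> 8 \<longrightarrow> x \<noteq> 9 \<longrightarrow> fst t' x = fst s x" "fst t' 8 = x" "fst t' 9 = y"
      "x < n" "y < n" "\<forall>a. a < 3 * ?N \<or> 3 * ?N + ?N \<le> a \<longrightarrow> snd t' a = snd s a"
    have "snd t' (2 * ?N + (x * n + y)) = snd s (2 * ?N + (x * n + y))"
      using *(6) index_less[OF *(4,5)] by simp
    also have "\<dots> = hops n T E\<^sub>\<Gamma> x y"
      using matD[OF _ *(4,5)] env by (simp add: env_def)
    moreover have "snd t' (fst s 4 + (x * n + y)) = snd s (fst s 4 + (x * n + y))"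
      using *(6) p(1) by simp
    ultimately show "val ?e t' = truncated_weight T (hop_dist E\<^sub>\<Gamma>) E x y"
      using * env adjD[OF p(2) *(4,5)] by (simp add: env_def truncated_weight_hop_dist[OF \<Gamma>])
  qed (use env in \<open>auto simp: env_def\<close>)
  have t: "fst t x = fst s x" if "x \<notin> {8, 9}" for x using that by (simp add: t_def sem_unassigned)
  have s': "s' = sem (floyd 3) t" by (simp add: s'_def relax_def t_def)
  show "mat n (snd s') (3 * ?N) (dists n T E\<^sub>\<Gamma> E)"
    unfolding s' dists_def using 1 t env by (intro sem_floyd) (auto simp: env_def)
  show "x \<notin> {8, 9, 10} \<Longrightarrow> fst s' x = fst s x" using t by (simp add: s' sem_unassigned)
  show "snd s' a = snd s a" if "a < 3 * ?N \<or> 5 * ?N \<le> a" for a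
  proof -
    have "snd s' a = snd t a" unfolding s' using 1 t env that by (intro sem_floyd) (auto simp: env_def)
    then show ?thesis using 1 that by auto
  qed
qed

lemma sem_find_conflict:
  assumes env: "env n T E\<^sub>\<Gamma> s" and C: "mat n (snd s) (3 * (n * n)) C"
  defines "s' \<equiv> sem find_conflict s"
  shows "snd s' = snd s"
    and "x \<notin> {8, 9, 13} \<Longrightarrow> fst s' x = fst s x"
    and "if fst s' 13 = 0 then \<forall>x<n. \<forall>y<n. {x, y} \<in> E\<^sub>\<Gamma> \<longrightarrow> C x y \<le> T
      else \<exists>x<n. \<exists>y<n. fst s' 13 = Suc x \<and> {x, y} \<in> E\<^sub>\<Gamma> \<and> \<not> C x y \<le> T"
proof -
  let ?N = "n * n"
  let ?c = "Assign 13
     (Cond (Mem (idx (block 1) 8 9))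
       (Cond (Minus (Mem (idx (block 3) 8 9)) (Reg 2)) (Plus (Reg 8) (Lit 1)) (Reg 13))
       (Reg 13))"
  \<comment> \<open>Once register 13 is nonzero, nothing is claimed about the pairs examined so far:
    one violated edge is enough for branching, and a later one may replace it.\<close>
  define I where "I = (\<lambda>q t. snd t = snd s \<and> (\<forall>x. x \<notin> {8, 9, 13} \<longrightarrow> fst t x = fst s x) \<and>
      (if fst t 13 = 0 then \<forall>p<q. {p div n, p mod n} \<in> E\<^sub>\<Gamma> \<longrightarrow> C (p div n) (p mod n) \<le> T
       else \<exists>x<n. \<exists>y<n. fst t 13 = Suc x \<and> {x, y} \<in> E\<^sub>\<Gamma> \<and> \<not> C x y \<le> T))"
  have "I ?N (sem (For 8 (For 9 ?c)) (set_reg 13 0 s))"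
  proof (rule sem_For_For_induct)
    fix q t assume q: "q < ?N" and t: "fst t 0 = n" "fst t 8 = q div n" "fst t 9 = q mod n" and I: "I q t"
    have "0 < n" using q by (cases n) auto
    then have qn: "q div n < n" "q mod n < n" using q by (auto simp: less_mult_imp_div_less)
    define bad where "bad \<longleftrightarrow> {q div n, q mod n} \<in> E\<^sub>\<Gamma> \<and> \<not> C (q div n) (q mod n) \<le> T"
    have "val (Mem (idx (block 1) 8 9)) t \<noteq> 0 \<longleftrightarrow> {q div n, q mod n} \<in> E\<^sub>\<Gamma>"
      using adjD[OF _ qn] env t I by (simp add: I_def env_def)
    moreover have "val (Mem (idx (block 3) 8 9)) t = C (q div n) (q mod n)"
      using matD[OF C qn] env t I by (simp add: I_def env_def)
    moreover have "fst t 2 = T" using I env by (simp add: I_def env_def)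
    ultimately have sem: "sem ?c t = set_reg 13 (if bad then Suc (q div n) else fst t 13) t"
      using t by (auto simp: bad_def simp del: val.simps(6) val_idx block.simps)
    show "I (Suc q) (sem ?c t)"
    proof (cases bad)
      case True
      then have "\<exists>x<n. \<exists>y<n. q div n = x \<and> {x, y} \<in> E\<^sub>\<Gamma> \<and> \<not> C x y \<le> T"
        using qn unfolding bad_def by blast
      then show ?thesis using I True unfolding sem by (simp add: I_def)
    next
      case False
      then have "sem ?c t = t" unfolding sem by (simp add: set_reg_def)
      moreover have "I (Suc q) t"
        using I False unfolding I_def bad_def less_Suc_eq by (cases "fst t 13 = 0") auto
      ultimately show ?thesis by (simp only:)
    qed
  qed (use env in \<open>auto simp: I_def env_def\<close>)
  then have I: "I ?N s'" by (simp add: s'_def find_conflict_def)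
  then show "snd s' = snd s" "x \<notin> {8, 9, 13} \<Longrightarrow> fst s' x = fst s x" unfolding I_def by blast+
  have "C x y \<le> T" if "x < n" "y < n" "{x, y} \<in> E\<^sub>\<Gamma>" "fst s' 13 = 0" for x y
  proof -
    have "(x * n + y) div n = x" "(x * n + y) mod n = y" using that by auto
    then show ?thesis using I index_less[OF that(1,2)] that(3,4) unfolding I_def by metis
  qed
  then show "if fst s' 13 = 0 then \<forall>x<n. \<forall>y<n. {x, y} \<in> E\<^sub>\<Gamma> \<longrightarrow> C x y \<le> T
      else \<exists>x<n. \<exists>y<n. fst s' 13 = Suc x \<and> {x, y} \<in> E\<^sub>\<Gamma> \<and> \<not> C x y \<le> T"
    using I unfolding I_def by (simp split: if_splits)
qed

text \<open>The entry of the parent ends at or before the tail, so it is intact while the child is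
  copied from it.\<close>

lemma sem_push_child:
  assumes s: "fst s 0 = n" "fst s 3 = n * n" "fst s 11 < n" "fst s 12 < n"
    and p: "node n (snd s) (fst s 4) (E, j)" "fst s 4 + (n * n + 1) \<le> fst s 5"
  defines "s' \<equiv> sem push_child s"
  shows "node n (snd s') (fst s 5) (insert {fst s 11, fst s 12} E, j - 1)"
    and "a < fst s 5 \<Longrightarrow> snd s' a = snd s a"
    and "fst s' 5 = fst s 5 + (n * n + 1)"
    and "x \<notin> {5, 8, 9} \<Longrightarrow> fst s' x = fst s x"
proof -
  let ?N = "n * n" and ?q = "fst s 5" and ?E = "insert {fst s 11, fst s 12} E"
  let ?e = "Cond (Plus (Cond (eq_expr (Reg 8) (Reg 11)) (eq_expr (Reg 9) (Reg 12)) (Lit 0))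
                   (Cond (eq_expr (Reg 8) (Reg 12)) (eq_expr (Reg 9) (Reg 11)) (Lit 0)))
          (Lit 1) (Mem (idx (Reg 4) 8 9))"
  define D where "D = (\<lambda>x y. if {x, y} = {fst s 11, fst s 12} then 1 else snd s (fst s 4 + (x * n + y)))"
  define t where "t = sem (fill 8 9 (Reg 5) ?e) s"
  have 1: "mat n (snd t) ?q D \<and> (\<forall>a. a < ?q \<or> ?q + ?N \<le> a \<longrightarrow> snd t a = snd s a)"
    unfolding t_def
  proof (rule sem_fill)
    fix t' :: state and x y :: nat
    assume *: "\<forall>x. x \<noteq> 8 \<longrightarrow> x \<noteq> 9 \<longrightarrow> fst t' x = fst s x" "fst t' 8 = x" "fst t' 9 = y"
      "x < n" "y < n" "\<forall>a. a < ?q \<or> ?q + ?N \<le> a \<longrightarrow> snd t' a = snd s a"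
    have "snd t' (fst s 4 + (x * n + y)) = snd s (fst s 4 + (x * n + y))"
      using *(6) index_less[OF *(4,5)] p(2) by simp
    then show "val ?e t' = D x y"
      using * s by (auto simp: D_def doubleton_eq_iff)
  qed (use s in auto)
  have t: "fst t x = fst s x" if "x \<notin> {8, 9}" for x using that by (simp add: t_def sem_unassigned)
  have j: "snd t (fst s 4 + ?N) = j" using 1 p by simp
  have s': "s' = set_reg 5 (?q + (?N + 1)) (fst t, (snd t)(?q + ?N := j - 1))"
  proof -
    have "s' = sem (Assign 5 (Plus (Reg 5) (Plus (Reg 3) (Lit 1))))
        (sem (Write (Plus (Reg 5) (Reg 3)) (Minus (Mem (Plus (Reg 4) (Reg 3))) (Lit 1))) t)"
      by (simp only: s'_def push_child_def sem.simps(3) t_def[symmetric])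
    then show ?thesis using t s j by simp
  qed
  have "adj n (snd t) ?q ?E" using 1 p(1) by (auto simp: adj_def mat_def D_def)
  moreover have "adj n (snd s') ?q ?E \<longleftrightarrow> adj n (snd t) ?q ?E" by (rule mat_cong) (simp add: s')
  ultimately show "node n (snd s') ?q (?E, j - 1)" by (simp add: s')
  show "a < ?q \<Longrightarrow> snd s' a = snd s a" using 1 by (simp add: s')
  show "fst s' 5 = ?q + (?N + 1)" by (simp add: s')
  show "x \<notin> {5, 8, 9} \<Longrightarrow> fst s' x = fst s x" using t by (simp add: s')
qed

text \<open>A pair of vertices is encoded by its row-major index. Keeping the upper limit
  \<open>q\<close> as a parameter lets the list describe the intermediate stages of the double
  loop.\<close>

definition child_pairs :: "nat \<Rightarrow> nat \<Rightarrow> nat set set \<Rightarrow> nat \<Rightarrow> nat \<Rightarrow> nat list" where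
  "child_pairs n T E\<^sub>\<Gamma> u q = filter (\<lambda>p. p div n < p mod n \<and> hops n T E\<^sub>\<Gamma> u (p div n) \<le> T \<and>
     hops n T E\<^sub>\<Gamma> u (p mod n) \<le> T) [0..<q]"

definition children ::
    "nat \<Rightarrow> nat \<Rightarrow> nat set set \<Rightarrow> nat \<Rightarrow> nat set set \<times> nat \<Rightarrow> nat \<Rightarrow> (nat set set \<times> nat) list" where
  "children n T E\<^sub>\<Gamma> u x q =
     map (\<lambda>p. (insert {p div n, p mod n} (fst x), snd x - 1)) (child_pairs n T E\<^sub>\<Gamma> u q)"

lemma sem_push_children:
  assumes env: "env n T E\<^sub>\<Gamma> s" and u: "fst s 14 < n" and p: "5 * (n * n) \<le> fst s 4"
    and queue: "queue n (snd s) (fst s 4) (x # xs) (fst s 5)"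
  defines "s' \<equiv> sem push_children s"
  shows "env n T E\<^sub>\<Gamma> s'" and "\<forall>y. y \<notin> {5, 8, 9, 11, 12, 13} \<longrightarrow> fst s' y = fst s y"
    and "queue n (snd s') (fst s 4) (x # xs @ children n T E\<^sub>\<Gamma> (fst s 14) x (n * n)) (fst s' 5)"
proof -
  let ?N = "n * n" and ?ch = "children n T E\<^sub>\<Gamma> (fst s 14) x"
  let ?e = "Cond (Minus (Reg 12) (Reg 11))
       (Cond (Minus (Plus (Reg 2) (Lit 1)) (Mem (idx (block 2) 14 11)))
         (Minus (Plus (Reg 2) (Lit 1)) (Mem (idx (block 2) 14 12))) (Lit 0)) (Lit 0)"
  let ?c = "Test ?e push_child (Assign 13 (Reg 13))"
  define I where "I = (\<lambda>q t. (\<forall>y. y \<notin> {5, 8, 9, 11, 12, 13} \<longrightarrow> fst t y = fst s y) \<and>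
      env n T E\<^sub>\<Gamma> t \<and> queue n (snd t) (fst s 4) (x # xs @ ?ch q) (fst t 5))"
  have "I ?N (sem (For 11 (For 12 ?c)) s)"
  proof (rule sem_For_For_induct)
    fix q t assume q: "q < ?N" and t: "fst t 0 = n" "fst t 11 = q div n" "fst t 12 = q mod n" and I: "I q t"
    have "0 < n" using q by (cases n) auto
    then have qn: "q div n < n" "q mod n < n" using q by (auto simp: less_mult_imp_div_less)
    have t': "fst t 3 = ?N" "fst t 2 = T" "fst t 14 = fst s 14" "fst t 4 = fst s 4"
      and envt: "env n T E\<^sub>\<Gamma> t" and qt: "queue n (snd t) (fst s 4) (x # xs @ ?ch q) (fst t 5)"
      using I by (auto simp: I_def env_def)
    have "snd t (2 * ?N + (fst s 14 * n + y)) = hops n T E\<^sub>\<Gamma> (fst s 14) y" if "y < n" for y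
      using matD[OF _ u that] envt by (simp add: env_def)
    \<comment> \<open>The truncated difference \<open>T + 1 - h\<close> is nonzero exactly if
      \<open>h \<le> T\<close>.\<close>
    then have e: "val ?e t \<noteq> 0 \<longleftrightarrow> q div n < q mod n \<and> hops n T E\<^sub>\<Gamma> (fst s 14) (q div n) \<le> T \<and>
        hops n T E\<^sub>\<Gamma> (fst s 14) (q mod n) \<le> T"
      using t t' qn by (simp add: less_Suc_eq_le)
    show "I (Suc q) (sem ?c t)"
    proof (cases "val ?e t \<noteq> 0")
      case True
      define t2 where "t2 = sem push_child t"
      obtain E j where x: "x = (E, j)" by (cases x)
      have le: "fst s 4 + (?N + 1) \<le> fst t 5" using queue_le[OF qt] by simp
      have nd: "node n (snd t) (fst t 4) (E, j)" using qt x t' by simp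
      note push = sem_push_child[of t n E j, folded t2_def, OF t(1) t'(1) _ _ nd,
          unfolded t t', OF qn le]
      have "env n T E\<^sub>\<Gamma> t2" using envt
        by (rule env_cong) (use push(4) push(2) p le in auto)
      moreover have "queue n (snd t2) (fst s 4) (x # xs @ ?ch q) (fst t 5)"
        using qt by (rule queue_cong) (use push(2) in auto)
      then have "queue n (snd t2) (fst s 4) ((x # xs @ ?ch q) @ [(insert {q div n, q mod n} E, j - 1)]) (fst t2 5)"
        using push(1,3) unfolding queue_append by auto
      moreover have "?ch (Suc q) = ?ch q @ [(insert {q div n, q mod n} E, j - 1)]"
        using True e by (simp add: children_def child_pairs_def x)
      moreover have "sem ?c t = t2" using True by (simp add: t2_def)
      ultimately show ?thesis using I push(4) by (auto simp: I_def)
    next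
      case False
      then have "?ch (Suc q) = ?ch q" using e by (auto simp: children_def child_pairs_def)
      moreover have "sem ?c t = t" using False by (simp add: set_reg_def)
      ultimately show ?thesis using I by (simp add: I_def)
    qed
  qed (use env queue in \<open>auto simp: I_def env_def children_def child_pairs_def push_child_def\<close>)
  then show "env n T E\<^sub>\<Gamma> s'" and "\<forall>y. y \<notin> {5, 8, 9, 11, 12, 13} \<longrightarrow> fst s' y = fst s y"
    and "queue n (snd s') (fst s 4) (x # xs @ ?ch ?N) (fst s' 5)"
    unfolding I_def s'_def push_children_def by blast+
qed

lemma sem_process_node:
  assumes \<Gamma>: "graph {..<n} E\<^sub>\<Gamma>" and env: "env n T E\<^sub>\<Gamma> s" and E: "graph {..<n} E"
    and p: "5 * (n * n) \<le> fst s 4" and queue: "queue n (snd s) (fst s 4) ((E, j) # xs) (fst s 5)"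
  defines "s' \<equiv> sem process_node s"
  shows "if spans T E\<^sub>\<Gamma> E then fst s' 6 = 0 \<and> fst s' 7 = 1
    else \<exists>u v ys. {u, v} \<in> E\<^sub>\<Gamma> \<and> \<not> weighted_dist (hop_dist E\<^sub>\<Gamma>) E u v \<le> enat T \<and>
      ys = xs @ (if j = 0 then [] else children n T E\<^sub>\<Gamma> u (E, j) (n * n)) \<and>
      env n T E\<^sub>\<Gamma> s' \<and> 5 * (n * n) \<le> fst s' 4 \<and> fst s' 7 = fst s 7 \<and>
      queue n (snd s') (fst s' 4) ys (fst s' 5) \<and> (fst s' 6 = 0 \<longleftrightarrow> ys = [])"
proof -
  let ?N = "n * n"
  have adj: "adj n (snd s) (fst s 4) E" using queue by simp
  define t1 where "t1 = sem relax s"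
  note relax = sem_relax[OF \<Gamma> env p adj, folded t1_def]
  have env1: "env n T E\<^sub>\<Gamma> t1" using env by (rule env_cong) (use relax(2,3) in auto)
  have queue1: "queue n (snd t1) (fst s 4) ((E, j) # xs) (fst s 5)"
    using queue by (rule queue_cong) (use relax(2) p in auto)
  define t2 where "t2 = sem find_conflict t1"
  note find = sem_find_conflict[OF env1 relax(1), folded t2_def]
  have env2: "env n T E\<^sub>\<Gamma> t2" using env1 by (rule env_cong) (use find(1,2) in auto)
  have t2: "fst t2 x = fst s x" if "x \<notin> {8, 9, 10, 13}" for x
    using that find(2) relax(3) by auto
  have edge: "u < n \<and> v < n" if "{u, v} \<in> E\<^sub>\<Gamma>" for u v
    using that \<Gamma> by (auto simp: graph_def vertex_pairs_def doubleton_eq_iff)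
  have s'_eq: "s' = sem (Test (Reg 13)
     (Then (Assign 14 (Minus (Reg 13) (Lit 1)))
     (Then (Test (Mem (Plus (Reg 4) (Reg 3))) push_children (Assign 13 (Reg 13)))
     (Then (Assign 4 (Plus (Reg 4) (Plus (Reg 3) (Lit 1))))
     (Assign 6 (Minus (Reg 5) (Reg 4))))))
     (Then (Assign 7 (Lit 1)) (Assign 6 (Lit 0)))) t2"
    by (simp only: s'_def process_node_def sem.simps(3) t1_def t2_def)
  show ?thesis
  proof (cases "fst t2 13 = 0")
    case True
    then have "dists n T E\<^sub>\<Gamma> E u v \<le> T" if "{u, v} \<in> E\<^sub>\<Gamma>" for u v
      using find(3) edge that by simp
    then have "spans T E\<^sub>\<Gamma> E" unfolding spans_def dists_le_iff[OF E] by blast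
    moreover have "fst s' 6 = 0 \<and> fst s' 7 = 1" using True by (simp add: s'_eq)
    ultimately show ?thesis by simp
  next
    case False
    then obtain u v where u: "u < n" "fst t2 13 = Suc u" "{u, v} \<in> E\<^sub>\<Gamma>" "\<not> dists n T E\<^sub>\<Gamma> E u v \<le> T"
      using find(3) by auto
    then have uv: "\<not> weighted_dist (hop_dist E\<^sub>\<Gamma>) E u v \<le> enat T" by (simp add: dists_le_iff[OF E])
    define t3 where "t3 = set_reg 14 u t2"
    have env3: "env n T E\<^sub>\<Gamma> t3" using env2 by (rule env_cong) (auto simp: t3_def)
    have t3: "fst t3 x = fst s x" if "x \<notin> {8, 9, 10, 13, 14}" for x
      using that t2 by (simp add: t3_def)
    have queue3: "queue n (snd t3) (fst t3 4) ((E, j) # xs) (fst t3 5)"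
      using queue1 t3 find(1) by (simp add: t3_def)
    have regs3: "fst t3 3 = ?N" "fst t3 14 = u" using env3 by (auto simp: env_def t3_def)
    define t4 where "t4 = sem (Test (Mem (Plus (Reg 4) (Reg 3))) push_children (Assign 13 (Reg 13))) t3"
    let ?ys = "xs @ (if j = 0 then [] else children n T E\<^sub>\<Gamma> u (E, j) ?N)"
    have val: "val (Mem (Plus (Reg 4) (Reg 3))) t3 = j" using queue3 regs3 by simp
    have 4: "env n T E\<^sub>\<Gamma> t4 \<and> (\<forall>y. y \<notin> {5, 8, 9, 11, 12, 13} \<longrightarrow> fst t4 y = fst t3 y) \<and>
        queue n (snd t4) (fst t3 4) ((E, j) # ?ys) (fst t4 5)"
    proof (cases "j = 0")
      case True
      then have "t4 = t3" unfolding t4_def using val by (simp add: set_reg_def)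
      then show ?thesis using env3 queue3 True by simp
    next
      case False
      then have "t4 = sem push_children t3" unfolding t4_def using val by simp
      then show ?thesis using sem_push_children[OF env3 _ _ queue3] regs3 u(1) p t3 False by auto
    qed
    have regs4: "fst t4 3 = ?N" "fst t4 4 = fst s 4" "fst t4 7 = fst s 7"
      using 4 regs3 t3 by (auto simp: env_def)
    have "s' = sem (Assign 6 (Minus (Reg 5) (Reg 4))) (sem (Assign 4 (Plus (Reg 4) (Plus (Reg 3) (Lit 1)))) t4)"
    proof -
      have "sem (Assign 14 (Minus (Reg 13) (Lit 1))) t2 = t3" using u by (simp add: t3_def)
      moreover have "val (Reg 13) t2 \<noteq> 0" using False by simp
      ultimately show ?thesis unfolding s'_eq t4_def by (simp only: sem.simps(3,4) if_True not_False_eq_True)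
    qed
    then have s': "s' = set_reg 6 (fst t4 5 - (fst s 4 + (?N + 1))) (set_reg 4 (fst s 4 + (?N + 1)) t4)"
      using regs4 by simp
    have queue': "queue n (snd s') (fst s' 4) ?ys (fst s' 5)"
      using 4 t3 by (simp add: s')
    \<comment> \<open>Every entry occupies \<open>n * n + 1 > 0\<close> cells, so head and tail
      coincide only for the empty queue.\<close>
    moreover have "fst s' 6 = 0 \<longleftrightarrow> ?ys = []"
      using queue_le[OF queue'] queue' by (auto simp: s')
    moreover have "env n T E\<^sub>\<Gamma> s'" using conjunct1[OF 4] by (rule env_cong) (auto simp: s')
    moreover have "5 * ?N \<le> fst s' 4" using p by (simp add: s')
    moreover have "fst s' 7 = fst s 7" using regs4 by (simp add: s')
    moreover have "\<not> spans T E\<^sub>\<Gamma> E" using u(3) uv by (auto simp: spans_def)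
    ultimately show ?thesis using u(3) uv by (simp only: if_False) blast
  qed
qed

section \<open>Correctness and size of the search tree\<close>

lemma div_mod_less: "p < n * n \<Longrightarrow> p div n < n \<and> p mod n < (n :: nat)"
  by (cases "n = 0") (auto simp: less_mult_imp_div_less)

text \<open>With budget 0 the violated edge rules out a solution, in accordance with the empty list
  of children. Otherwise this is \<open>augmentable_Suc\<close> with the pair of vertices replaced
  by its index.\<close>

lemma augmentable_iff_children:
  assumes \<Gamma>: "graph {..<n} E\<^sub>\<Gamma>" and uv: "{u, v} \<in> E\<^sub>\<Gamma>" "\<not> weighted_dist (hop_dist E\<^sub>\<Gamma>) E u v \<le> enat T"
  shows "augmentable T {..<n} E\<^sub>\<Gamma> j E \<longleftrightarrow>
    (\<exists>y\<in>set (if j = 0 then [] else children n T E\<^sub>\<Gamma> u (E, j) (n * n)). augmentable T {..<n} E\<^sub>\<Gamma> (snd y) (fst y))"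
proof (cases j)
  case 0
  then show ?thesis using augmentable_0[of "{..<n}" T E\<^sub>\<Gamma> E] uv by (auto simp: spans_def)
next
  case (Suc i)
  let ?P = "\<lambda>x y. x < y \<and> hop_dist E\<^sub>\<Gamma> u x \<le> enat T \<and> hop_dist E\<^sub>\<Gamma> u y \<le> enat T \<and>
      augmentable T {..<n} E\<^sub>\<Gamma> i (insert {x, y} E)"
  have "(\<exists>x\<in>{..<n}. \<exists>y\<in>{..<n}. ?P x y) \<longleftrightarrow> (\<exists>p<n * n. ?P (p div n) (p mod n))"
  proof
    assume "\<exists>x\<in>{..<n}. \<exists>y\<in>{..<n}. ?P x y"
    then obtain x y where xy: "x < n" "y < n" "?P x y" by auto
    then have "(x * n + y) div n = x" "(x * n + y) mod n = y" by auto
    then show "\<exists>p<n * n. ?P (p div n) (p mod n)" using index_less[OF xy(1,2)] xy(3) by metis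
  qed (use div_mod_less in blast)
  also have "\<dots> \<longleftrightarrow> (\<exists>y\<in>set (children n T E\<^sub>\<Gamma> u (E, j) (n * n)). augmentable T {..<n} E\<^sub>\<Gamma> (snd y) (fst y))"
    by (auto simp: children_def child_pairs_def Suc hops_le_iff[OF \<Gamma>])
  finally show ?thesis using augmentable_Suc[OF _ uv, of "{..<n}" i] Suc by simp
qed

lemma graph_children:
  assumes "graph {..<n} (fst x)" "y \<in> set (children n T E\<^sub>\<Gamma> u x (n * n))"
  shows "graph {..<n} (fst y)"
proof -
  obtain p where p: "p < n * n" "p div n < p mod n" "fst y = insert {p div n, p mod n} (fst x)"
    using assms(2) by (auto simp: children_def child_pairs_def)
  then have "{p div n, p mod n} \<in> vertex_pairs {..<n}"
    using div_mod_less[OF p(1)] unfolding vertex_pairs_def mem_Collect_eq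
    by (intro exI[of _ "p div n"] exI[of _ "p mod n"]) simp
  then show ?thesis using assms(1) p(3) by (simp add: graph_def)
qed

lemma length_child_pairs:
  assumes \<Gamma>: "graph {..<n} E\<^sub>\<Gamma>"
  shows "length (child_pairs n T E\<^sub>\<Gamma> u q) \<le> 4 * max 1 (max_degree {..<n} E\<^sub>\<Gamma>) ^ (4 * T)"
proof -
  let ?B = "{x. hop_dist E\<^sub>\<Gamma> u x \<le> enat T}" and ?M = "max 1 (max_degree {..<n} E\<^sub>\<Gamma>)"
  have "length (child_pairs n T E\<^sub>\<Gamma> u q) = card (set (child_pairs n T E\<^sub>\<Gamma> u q))"
    by (rule distinct_card[symmetric]) (simp add: child_pairs_def)
  also have "\<dots> \<le> card (?B \<times> ?B)"
  proof (rule card_inj_on_le)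
    show "inj_on (\<lambda>p. (p div n, p mod n)) (set (child_pairs n T E\<^sub>\<Gamma> u q))"
    proof (rule inj_onI)
      fix a b assume "(a div n, a mod n) = (b div n, b mod n)"
      then have "a div n * n + a mod n = b div n * n + b mod n" by simp
      then show "a = b" by (simp only: div_mult_mod_eq)
    qed
    show "(\<lambda>p. (p div n, p mod n)) ` set (child_pairs n T E\<^sub>\<Gamma> u q) \<subseteq> ?B \<times> ?B"
      by (auto simp: child_pairs_def hops_le_iff[OF \<Gamma>])
  qed (use card_ball_le(1)[OF \<Gamma>] in simp)
  also have "\<dots> \<le> (2 * ?M ^ (2 * T)) * (2 * ?M ^ (2 * T))"
    unfolding card_cartesian_product using card_ball_le(2)[OF \<Gamma>] by (intro mult_mono) auto
  also have "\<dots> = 4 * (?M ^ (2 * T) * ?M ^ (2 * T))" by simp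
  also have "?M ^ (2 * T) * ?M ^ (2 * T) = ?M ^ (4 * T)" by (simp flip: power_add)
  finally show ?thesis .
qed

text \<open>This counts the nodes of the complete \<open>b\<close>-ary tree of depth
  \<open>j\<close>.\<close>

primrec tree_size :: "nat \<Rightarrow> nat \<Rightarrow> nat" where
  "tree_size b 0 = 1"
| "tree_size b (Suc j) = 1 + b * tree_size b j"

text \<open>There are \<open>k + 1\<close> levels, none with more than \<open>b ^ k\<close>
  nodes.\<close>

lemma tree_size_le: "1 \<le> b \<Longrightarrow> tree_size b k \<le> (k + 1) * b ^ k"
proof (induction k)
  case (Suc k)
  have "b * tree_size b k \<le> b * ((k + 1) * b ^ k)" using Suc by (intro mult_left_mono) auto
  moreover have "1 \<le> b * b ^ k" using one_le_power[OF Suc.prems, of "Suc k"] by simp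
  ultimately show ?case by (simp add: algebra_simps del: One_nat_def)
qed simp

text \<open>The variant of the search loop: a bound on the number of nodes still to be visited, each
  queue entry accounting for its whole subtree.\<close>

definition queue_size :: "nat \<Rightarrow> (nat set set \<times> nat) list \<Rightarrow> nat" where
  "queue_size b xs = (\<Sum>x\<leftarrow>xs. tree_size b (snd x))"

text \<open>The subtree of the processed node is replaced by those of its at most \<open>b\<close>
  children, so at least its root is lost.\<close>

lemma queue_size_children:
  assumes "length (child_pairs n T E\<^sub>\<Gamma> u (n * n)) \<le> b"
  shows "queue_size b (xs @ (if j = 0 then [] else children n T E\<^sub>\<Gamma> u (E, j) (n * n)))
    < queue_size b ((E, j) # xs)"
proof (cases j)
  case (Suc i)
  have "queue_size b (children n T E\<^sub>\<Gamma> u (E, j) (n * n)) =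
      length (child_pairs n T E\<^sub>\<Gamma> u (n * n)) * tree_size b i"
    by (simp add: queue_size_def children_def Suc comp_def sum_list_triv)
  also have "\<dots> \<le> b * tree_size b i" using assms by (rule mult_right_mono) simp
  finally show ?thesis by (simp add: queue_size_def Suc)
qed (simp add: queue_size_def)

text \<open>\<open>A\<close> is the answer of the original instance and stays fixed. Register 7 is 0
  until a solution turns up, so an emptied queue reports failure by itself. Once the flag is 0, the
  condition holds for every \<open>q\<close>.\<close>

definition search_state :: "nat \<Rightarrow> nat \<Rightarrow> nat set set \<Rightarrow> nat \<Rightarrow> bool \<Rightarrow> nat \<Rightarrow> state \<Rightarrow> bool" where
  "search_state n T E\<^sub>\<Gamma> b A q s \<longleftrightarrow> fst s 0 = n \<and>
     (if fst s 6 = 0 then fst s 7 = of_bool A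
      else env n T E\<^sub>\<Gamma> s \<and> 5 * (n * n) \<le> fst s 4 \<and> fst s 7 = 0 \<and>
        (\<exists>xs. xs \<noteq> [] \<and> (\<forall>x\<in>set xs. graph {..<n} (fst x)) \<and> queue n (snd s) (fst s 4) xs (fst s 5) \<and>
          (A \<longleftrightarrow> (\<exists>x\<in>set xs. augmentable T {..<n} E\<^sub>\<Gamma> (snd x) (fst x))) \<and> queue_size b xs \<le> q))"

lemma search_step:
  assumes \<Gamma>: "graph {..<n} E\<^sub>\<Gamma>" and b: "4 * max 1 (max_degree {..<n} E\<^sub>\<Gamma>) ^ (4 * T) \<le> b"
    and s: "search_state n T E\<^sub>\<Gamma> b A q s" "fst s 6 \<noteq> 0"
  shows "\<exists>q'<q. search_state n T E\<^sub>\<Gamma> b A q' (sem process_node s)"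
proof -
  let ?aug = "\<lambda>x. augmentable T {..<n} E\<^sub>\<Gamma> (snd x) (fst x)"
  define s' where "s' = sem process_node s"
  have env: "env n T E\<^sub>\<Gamma> s" and p: "5 * (n * n) \<le> fst s 4" and s7: "fst s 7 = 0"
    using s by (auto simp: search_state_def)
  obtain xs0 where xs0: "xs0 \<noteq> []" "\<forall>x\<in>set xs0. graph {..<n} (fst x)"
      "queue n (snd s) (fst s 4) xs0 (fst s 5)" "A \<longleftrightarrow> (\<exists>x\<in>set xs0. ?aug x)" "queue_size b xs0 \<le> q"
    using s unfolding search_state_def by auto
  obtain E j xs where xs: "xs0 = (E, j) # xs" using xs0(1) by (cases xs0) auto
  have E: "graph {..<n} E" using xs0(2) xs by simp
  have n': "fst s' 0 = n"
    using env sem_unassigned[of 0 process_node s] by (simp add: s'_def env_def process_node_def relax_def find_conflict_def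
        push_children_def push_child_def)
  note spec = sem_process_node[OF \<Gamma> env E p xs0(3)[unfolded xs], folded s'_def]
  have "1 \<le> tree_size b j" by (cases j) auto
  then have "0 < q" using xs0(5) xs by (simp add: queue_size_def)
  show ?thesis
  proof (cases "spans T E\<^sub>\<Gamma> E")
    case True
    then have "A" using xs0(4) xs augmentable_spans by fastforce
    then have "search_state n T E\<^sub>\<Gamma> b A 0 s'" using True spec n' by (simp add: search_state_def)
    then show ?thesis using \<open>0 < q\<close> s'_def by blast
  next
    case False
    then obtain u v ys where uv: "{u, v} \<in> E\<^sub>\<Gamma>" "\<not> weighted_dist (hop_dist E\<^sub>\<Gamma>) E u v \<le> enat T"
      and ys: "ys = xs @ (if j = 0 then [] else children n T E\<^sub>\<Gamma> u (E, j) (n * n))"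
      and s': "env n T E\<^sub>\<Gamma> s'" "5 * (n * n) \<le> fst s' 4" "fst s' 7 = fst s 7"
        "queue n (snd s') (fst s' 4) ys (fst s' 5)" "fst s' 6 = 0 \<longleftrightarrow> ys = []"
      using spec unfolding if_not_P[OF False] by (elim exE conjE) (rule that)
    have "A \<longleftrightarrow> (\<exists>x\<in>set ys. ?aug x)"
      using xs0(4) augmentable_iff_children[OF \<Gamma> uv, of j] by (auto simp: xs ys)
    moreover have "\<forall>x\<in>set ys. graph {..<n} (fst x)"
      using xs0(2) graph_children[of n "(E, j)"] E by (auto simp: xs ys split: if_splits)
    moreover have "queue_size b ys < q"
      using queue_size_children[of n T E\<^sub>\<Gamma> u b xs j E] length_child_pairs[OF \<Gamma>, of T u "n * n"] b xs0(5)
      by (simp add: ys xs)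
    ultimately have "search_state n T E\<^sub>\<Gamma> b A (queue_size b ys) s'"
      using s' n' s7 by (cases "ys = []") (auto simp: search_state_def)
    then show ?thesis using \<open>queue_size b ys < q\<close> s'_def by blast
  qed
qed

section \<open>The complete program\<close>

text \<open>Level 15 is the first one above the registers 0 to 14 of the source programs.\<close>

definition solver :: "nat \<Rightarrow> program" where
  "solver T = Seq (LoadConst 2 T) (Seq (compile 15 init)
     (Seq (WhileNZ 6 (compile 15 process_node)) (Seq (LoadConst 0 0) (Add 0 0 7))))"

lemma com_below_solver: "com_below 15 init" "com_below 15 process_node"
  by (simp_all add: init_def process_node_def relax_def find_conflict_def push_children_def
      push_child_def floyd_def fill_def idx_def eq_expr_def eval_nat_numeral)

lemma solver_correct:
  fixes k :: nat
  assumes "graph {..<n} E\<^sub>G" and \<Gamma>: "graph {..<n} E\<^sub>\<Gamma>"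
    and b: "4 * max 1 (max_degree {..<n} E\<^sub>\<Gamma>) ^ (4 * T) \<le> b"
  defines "A \<equiv> augmentable T {..<n} E\<^sub>\<Gamma> k E\<^sub>G"
  shows "\<exists>s'. runs (solver T) (input_state n E\<^sub>G E\<^sub>\<Gamma> k) s'
      (tree_size b k * (com_time init n + com_time process_node n + 5)) \<and> fst s' 0 = of_bool A"
proof -
  obtain r m where in_eq: "input_state n E\<^sub>G E\<^sub>\<Gamma> k = (r, m)" by (cases "input_state n E\<^sub>G E\<^sub>\<Gamma> k")
  have r: "r = (\<lambda>_. 0)(0 := n, 1 := k)" and m: "m = (\<lambda>a. if a < n * n then adjacency_entry n E\<^sub>G a
          else if a < 2 * (n * n) then adjacency_entry n E\<^sub>\<Gamma> (a - n * n) else 0)"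
    using in_eq by (auto simp: input_state_def)
  have "adj n m 0 E\<^sub>G" "adj n m (n * n) E\<^sub>\<Gamma>"
    using index_less by (auto simp: adj_def m adjacency_entry_def)
  then have init: "env n T E\<^sub>\<Gamma> (sem init (r(2 := T), m)) \<and> fst (sem init (r(2 := T), m)) 4 = 5 * (n * n) \<and>
      fst (sem init (r(2 := T), m)) 6 = 1 \<and> fst (sem init (r(2 := T), m)) 7 = 0 \<and>
      queue n (snd (sem init (r(2 := T), m))) (5 * (n * n)) [(E\<^sub>G, k)] (fst (sem init (r(2 := T), m)) 5)"
    by (intro sem_init[OF \<Gamma>]) (auto simp: r)
  obtain \<rho> where \<rho>: "runs (compile 15 init) (r(2 := T), m) (\<rho>, snd (sem init (r(2 := T), m))) (com_time init n)"
      "\<forall>x<15. \<rho> x = fst (sem init (r(2 := T), m)) x"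
    using compile_correct[OF com_below_solver(1), of 15 "r(2 := T)" "(r(2 := T), m)"] by (auto simp: r)
  \<comment> \<open>The machine state differs from the source state in the scratch registers, so the
    invariant is carried by a source state \<open>s\<close> that agrees with it below register
    15.\<close>
  define J where "J = (\<lambda>q t. \<exists>s. search_state n T E\<^sub>\<Gamma> b A q s \<and> snd t = snd s \<and> (\<forall>x<15. fst t x = fst s x))"
  have step: "\<exists>q'<q. \<exists>t'. runs (compile 15 process_node) t t' (com_time process_node n) \<and> J q' t'"
    if J: "J q t" and nz: "fst t 6 \<noteq> 0" for q t
  proof -
    obtain s where s: "search_state n T E\<^sub>\<Gamma> b A q s" "snd t = snd s" "\<forall>x<15. fst t x = fst s x"
      using J unfolding J_def by blast
    have "fst s 6 \<noteq> 0" "fst s 0 = n" using s nz by (auto simp: search_state_def)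
    then obtain q' where q': "q' < q" "search_state n T E\<^sub>\<Gamma> b A q' (sem process_node s)"
      using search_step[OF \<Gamma> b s(1)] by blast
    obtain \<rho>' where \<rho>': "runs (compile 15 process_node) (fst t, snd s) (\<rho>', snd (sem process_node s))
        (com_time process_node n)" "\<forall>x<15. \<rho>' x = fst (sem process_node s) x"
      using compile_correct[OF com_below_solver(2), of 15 "fst t" s] s(3) \<open>fst s 0 = n\<close> by auto
    have "(fst t, snd s) = t" using s(2) by (metis prod.collapse)
    moreover have "J q' (\<rho>', snd (sem process_node s))"
      unfolding J_def using q'(2) \<rho>'(2) by (intro exI[of _ "sem process_node s"]) simp
    ultimately show ?thesis using q'(1) \<rho>'(1) by auto
  qed
  have "search_state n T E\<^sub>\<Gamma> b A (tree_size b k) (sem init (r(2 := T), m))"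
    using init assms(1) by (auto simp: search_state_def env_def queue_size_def A_def intro!: exI[of _ "[(E\<^sub>G, k)]"])
  then have "J (tree_size b k) (\<rho>, snd (sem init (r(2 := T), m)))" using \<rho>(2)
    unfolding J_def by (intro exI[of _ "sem init (r(2 := T), m)"]) simp
  from runs_WhileNZ[where J = J, OF step this]
  obtain q t where t: "runs (WhileNZ 6 (compile 15 process_node)) (\<rho>, snd (sem init (r(2 := T), m))) t
      (tree_size b k * (com_time process_node n + 1) + 1)" "J q t" "fst t 6 = 0"
    by blast
  then have t7: "fst t 7 = of_bool A" by (auto simp: J_def search_state_def)
  obtain r1 m1 where t_eq: "t = (r1, m1)" by (cases t)
  define r2 where "r2 = r1(0 := 0)"
  have "runs (solver T) (r, m) (r2(0 := r2 0 + r2 7), m1)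
      (1 + (com_time init n + ((tree_size b k * (com_time process_node n + 1) + 1) + (1 + 1))))"
    unfolding solver_def r2_def
    by (rule runs_Seq[OF runs_basic(1) runs_Seq[OF \<rho>(1) runs_Seq[OF t(1)[unfolded t_eq]
          runs_Seq[OF runs_basic(1) runs_basic(2)]]]])
  \<comment> \<open>The time spent outside the loop is charged to the root of the search tree, which
    gives a product in place of a sum.\<close>
  moreover have "1 + (com_time init n + ((tree_size b k * (com_time process_node n + 1) + 1) + (1 + 1)))
      \<le> tree_size b k * (com_time init n + com_time process_node n + 5)"
  proof -
    have "1 \<le> tree_size b k" by (cases k) auto
    then have "1 * (com_time init n + 4) \<le> tree_size b k * (com_time init n + 4)" by (intro mult_right_mono) auto
    then show ?thesis by (simp add: algebra_simps)
  qed
  ultimately have "runs (solver T) (input_state n E\<^sub>G E\<^sub>\<Gamma> k) (r2(0 := r2 0 + r2 7), m1)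
      (tree_size b k * (com_time init n + com_time process_node n + 5))"
    unfolding in_eq by (rule runs_mono)
  moreover have "fst (r2(0 := r2 0 + r2 7), m1) 0 = of_bool A" using t7 by (simp add: t_eq r2_def)
  ultimately show ?thesis by blast
qed

section \<open>Estimating the number of nodes\<close>

text \<open>For \<open>k \<ge> 2\<close> the logarithm is at least 1 and \<open>8 = 2 ^ 3\<close>
  gives the exponent. For \<open>k = 1\<close> the product \<open>k log k\<close> vanishes, so the
  leading factor 8 has to cover \<open>8 ^ 1\<close>.\<close>

lemma eight_power_le: "8 ^ k \<le> 8 * 2 powr (3 * (real k * log 2 (real k)))"
proof (cases "k \<le> 1")
  case True
  then show ?thesis by (cases k) auto
next
  case False
  have "(8 :: real) ^ k = 2 powr (3 * real k)"
    by (simp add: powr_powr[symmetric] powr_realpow)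
  also have "\<dots> \<le> 2 powr (3 * (real k * log 2 (real k)))"
  proof -
    have "1 \<le> log 2 (real k)" using False by (subst le_log_iff) auto
    then have "real k * 1 \<le> real k * log 2 (real k)" by (intro mult_left_mono) auto
    then show ?thesis by (intro powr_mono) auto
  qed
  also have "\<dots> \<le> 8 * 2 powr (3 * (real k * log 2 (real k)))" by simp
  finally show ?thesis .
qed

text \<open>The number of levels is absorbed by \<open>k + 1 \<le> 2 ^ k\<close>, which together
  with \<open>4 ^ k\<close> makes \<open>8 ^ k\<close>. Since \<open>1 \<le> M\<close>, the exponent
  may grow from \<open>\<lfloor>t\<rfloor>\<close> to \<open>t\<close>.\<close>

lemma tree_size_bound:
  fixes t :: real
  assumes "0 < t" "1 \<le> M"
  shows "real (tree_size (4 * M ^ (4 * nat \<lfloor>t\<rfloor>)) k) \<le>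
    8 * 2 powr (3 * (real k * log 2 (real k))) * real M powr (4 * (real k * t))"
proof -
  let ?T = "nat \<lfloor>t\<rfloor>"
  have "tree_size (4 * M ^ (4 * ?T)) k \<le> (k + 1) * (4 * M ^ (4 * ?T)) ^ k"
    using assms(2) by (intro tree_size_le) (simp add: Suc_leI)
  also have "\<dots> = (k + 1) * 4 ^ k * M ^ (4 * ?T * k)"
    unfolding power_mult_distrib power_mult[symmetric] by (simp only: mult.assoc)
  also have "\<dots> \<le> 2 ^ k * 4 ^ k * M ^ (4 * ?T * k)"
    using less_exp[of k] by (intro mult_right_mono) (auto simp: Suc_le_eq)
  also have "\<dots> = 8 ^ k * M ^ (4 * ?T * k)" by (simp flip: power_mult_distrib)
  finally have "real (tree_size (4 * M ^ (4 * ?T)) k) \<le> 8 ^ k * real M ^ (4 * ?T * k)"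
    by (metis (mono_tags, lifting) of_nat_le_iff of_nat_mult of_nat_numeral of_nat_power)
  also have "\<dots> \<le> (8 * 2 powr (3 * (real k * log 2 (real k)))) * real M powr (4 * (real k * t))"
  proof (rule mult_mono[OF eight_power_le])
    have "real ?T \<le> t" using assms(1) by linarith
    then have "real k * real ?T \<le> real k * t" by (intro mult_left_mono) auto
    then have "real (4 * ?T * k) \<le> 4 * (real k * t)" by (simp add: mult.commute)
    then have "real M powr real (4 * ?T * k) \<le> real M powr (4 * (real k * t))"
      using assms(2) by (intro powr_mono) auto
    then show "real M ^ (4 * ?T * k) \<le> real M powr (4 * (real k * t))"
      using assms(2) by (subst powr_realpow[symmetric]) auto
  qed auto
  finally show ?thesis .
qed

theorem theorem22:
  "\<exists>(c\<^sub>0::real) (c\<^sub>1::real) (c\<^sub>2::real) (c\<^sub>3::nat). \<forall>t::real. t > 0 \<longrightarrow>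
     (\<exists>P::program. \<forall>(n::nat) (k::nat) E\<^sub>G E\<^sub>\<Gamma>.
        n \<ge> 1 \<longrightarrow> graph {..<n} E\<^sub>G \<longrightarrow> graph {..<n} E\<^sub>\<Gamma> \<longrightarrow>
        answers_within P (input_state n E\<^sub>G E\<^sub>\<Gamma> k)
          (dilation_augmentation t {..<n} E\<^sub>G E\<^sub>\<Gamma> k)
          (time_bound c\<^sub>0 c\<^sub>1 c\<^sub>2 c\<^sub>3 t k (max_degree {..<n} E\<^sub>\<Gamma>) n))"
proof -
  obtain C1 p1 C2 p2 where 1: "\<forall>n\<ge>1. com_time init n \<le> C1 * n ^ p1"
    and 2: "\<forall>n\<ge>1. com_time process_node n \<le> C2 * n ^ p2"
    using com_time_bound by meson
  define C where "C = C1 + C2 + 5"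
  define p where "p = p1 + p2"
  have time: "com_time init n + com_time process_node n + 5 \<le> C * n ^ p" if "1 \<le> n" for n
  proof -
    have "com_time init n + com_time process_node n \<le> (C1 + C2) * n ^ (p1 + p2)" if "1 \<le> n" for n
      using poly_bound_add[of "com_time init" C1 p1 "com_time process_node" C2 p2] 1 2 that by simp
    from poly_bound_add[of _ _ _ "\<lambda>_. 5" 5 0, OF this _ that] show ?thesis
      by (simp add: C_def p_def)
  qed
  show ?thesis
  \<comment> \<open>The 8 and the 3 stem from \<open>eight_power_le\<close>, the 4 from squaring the
    ball bound with exponent \<open>2 * T\<close>, and \<open>C\<close> and \<open>p\<close> from
    the polynomial cost of the code.\<close>
  proof (rule exI[of _ "8 * real C"], rule exI[of _ 3], rule exI[of _ 4], rule exI[of _ p],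
      intro allI impI)
    fix t :: real assume t: "0 < t"
    show "\<exists>P. \<forall>n k E\<^sub>G E\<^sub>\<Gamma>. n \<ge> 1 \<longrightarrow> graph {..<n} E\<^sub>G \<longrightarrow> graph {..<n} E\<^sub>\<Gamma> \<longrightarrow>
        answers_within P (input_state n E\<^sub>G E\<^sub>\<Gamma> k)
          (dilation_augmentation t {..<n} E\<^sub>G E\<^sub>\<Gamma> k)
          (time_bound (8 * real C) 3 4 p t k (max_degree {..<n} E\<^sub>\<Gamma>) n)"
    proof (rule exI[of _ "solver (nat \<lfloor>t\<rfloor>)"], intro allI impI)
      fix n k E\<^sub>G E\<^sub>\<Gamma>
      assume n: "1 \<le> (n :: nat)" and G: "graph {..<n} E\<^sub>G" "graph {..<n} E\<^sub>\<Gamma>"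
      define M where "M = max 1 (max_degree {..<n} E\<^sub>\<Gamma>)"
      let ?q = "tree_size (4 * M ^ (4 * nat \<lfloor>t\<rfloor>)) k"
      obtain s' where s': "runs (solver (nat \<lfloor>t\<rfloor>)) (input_state n E\<^sub>G E\<^sub>\<Gamma> k) s'
          (?q * (com_time init n + com_time process_node n + 5))"
          "fst s' 0 = of_bool (dilation_augmentation t {..<n} E\<^sub>G E\<^sub>\<Gamma> k)"
        using solver_correct[OF G, of "nat \<lfloor>t\<rfloor>" "4 * M ^ (4 * nat \<lfloor>t\<rfloor>)" k]
        unfolding dilation_augmentation_iff_augmentable[OF t G(2)] M_def by blast
      have "real (?q * (com_time init n + com_time process_node n + 5)) \<le> real ?q * real (C * n ^ p)"
        unfolding of_nat_mult[symmetric] of_nat_le_iff using time[OF n] by (rule mult_left_mono) simp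
      also have "\<dots> \<le> (8 * 2 powr (3 * (real k * log 2 (real k))) * real M powr (4 * (real k * t))) * real (C * n ^ p)"
        by (intro mult_right_mono tree_size_bound t) (auto simp: M_def)
      also have "\<dots> = time_bound (8 * real C) 3 4 p t k (max_degree {..<n} E\<^sub>\<Gamma>) n"
        by (simp add: time_bound_def M_def)
      finally show "answers_within (solver (nat \<lfloor>t\<rfloor>)) (input_state n E\<^sub>G E\<^sub>\<Gamma> k)
          (dilation_augmentation t {..<n} E\<^sub>G E\<^sub>\<Gamma> k)
          (time_bound (8 * real C) 3 4 p t k (max_degree {..<n} E\<^sub>\<Gamma>) n)"
        using s' unfolding answers_within_def runs_def by (smt (verit) of_bool_def of_nat_le_iff)
    qed
  qed
qed

end
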